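(* Let $\mathcal P=\{p_1,\dots,p_t\}$ be a finite poset. (a) If $\mathcal P$ is a chain, then each $\mathcal P$-system of subspaces of a unitary space is isometric to an orthogonal direct sum, uniquely determined up to permutation of summands, of $\mathcal P$-systems of the form $\mathcal F_1,\dots,\mathcal F_t,\mathcal F$. (b) If $\mathcal P$ is a semichain, then each $\mathcal P$-system of subspaces of a unitary space is isometric to an orthogonal direct sum, uniquely determined up to permutation of summands, of $\mathcal P$-systems of the form $\mathcal F_1,\dots,\mathcal F_t,\mathcal F$ and of the form $\mathcal G_{k,\sigma},\mathcal G_k$ in which $p_k\nprec p_{k+1}$ and $\sigma$ is a positive real number.
   Context: $\mathcal P$ is a finite set with a partial order $\preccurlyeq$, whose elements $p_1,\dots,p_t$ are enumerated so that $p_i\prec p_j$ implies $i<j$. Unitary spaces are finite-dimensional complex inner product spaces. A $\mathcal P$-system (of subspaces of a unitary space) is a system $\mathcal U=(U_1,\dots,U_t)_U$ in which $U$ is a unitary space and $U_1,\dots,U_t$ are subspaces of $U$ such that $U_i\subseteq U_j$ whenever $p_i\prec p_j$. Two $\mathcal P$-systems $(U_1,\dots,U_t)_U$ and $(V_1,\dots,V_t)_V$ are isometric if there is a linear bijection $\varphi:U\to V$ preserving the scalar product with $\varphi(U_i)=V_i$ for all $i$. The orthogonal direct sum is $\mathcal U\perp\mathcal V:=(U_1+V_1,\dots,U_t+V_t)_{U\perp V}$, where $U\perp V$ is the orthogonal direct sum of the unitary spaces $U$ and $V$. (The system on the zero space is the empty orthogonal direct sum.) $\mathcal P$ is a chain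 if $p_1\prec p_2\prec\dots\prec p_t$. $\mathcal P$ is a semichain if it has the form $\mathcal P_1\prec\mathcal P_2\prec\dots\prec\mathcal P_s$, i.e. it is a disjoint union of subsets $\mathcal P_1,\dots,\mathcal P_s$, where every $\mathcal P_i$ consists of one element or of two incomparable elements, and $\mathcal P_i\prec\mathcal P_{i+1}$ means that $a\prec b$ for all $a\in\mathcal P_i$, $b\in\mathcal P_{i+1}$. For a semichain $\mathcal P$ (in particular for a chain) define the following $\mathcal P$-systems, where $\mathbb C$ and $\mathbb C\perp\mathbb C$ carry the usual scalar products: - $\mathcal F_k:=(0,\dots,0,\mathbb C,\dots,\mathbb C)_{\mathbb C}$ with $k-1$ zeros, for each $k=1,\dots,t$; - $\mathcal F:=(0,\dots,0)_{\mathbb C}$; - $\mathcal G_{k,\sigma}:=(0,\dots,0,\mathbb C(1,0),\mathbb C(\sigma,1),\mathbb C\perp\mathbb C,\dots,\mathbb C\perp\mathbb C)_{\mathbb C\perp\mathbb C}$ with $k-1$ zeros (so $\mathbb C(1,0)$ and $\mathbb C(\sigma,1)$ are in positions $k$ and $k+1$), for each $k$ with $1\le k<t$ and $p_k\nprec p_{k+1}$ and each positive real $\sigma$; here $(1,0)$ and $(\sigma,1)$ are elements of $\mathbb C\perp\mathbb C$ and $\mathbb Cv$ denotes the line spanned by $v$; - $\mathcal G_k:=(0,\dots,0,\mathbb C,0,\mathbb C,\dots,\mathbb C)_{\mathbb C}$ with $k-1$ zeros before the first $\mathbb C$ (so position $k$ is $\mathbb C$, position $k+1$ is $0$, and all later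 positions are $\mathbb C$), for each $k$ with $1\le k<t$ and $p_k\nprec p_{k+1}$. *)

theory Defs
  imports
    Complex_Main
    "HOL-Library.Multiset"
    "HOL-Library.Disjoint_Sets"
    "HOL-Library.Function_Algebras"
    "HOL-Library.Product_Plus"
begin

section \<open>Finite posets, chains and semichains\<close>

definition strictly :: "'p rel \<Rightarrow> 'p \<Rightarrow> 'p \<Rightarrow> bool" where
  "strictly r a b \<longleftrightarrow> (a, b) \<in> r \<and> a \<noteq> b"

definition enumerated_poset :: "'p set \<Rightarrow> 'p rel \<Rightarrow> nat \<Rightarrow> (nat \<Rightarrow> 'p) \<Rightarrow> bool" where
  "enumerated_poset P r t p \<longleftrightarrow>
     finite P \<and> partial_order_on P r \<and> bij_betw p {1..t} P \<and>
     (\<forall>i\<in>{1..t}. \<forall>j\<in>{1..t}. strictly r (p i) (p j) \<longrightarrow> i < j)"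

definition poset_chain :: "'p rel \<Rightarrow> nat \<Rightarrow> (nat \<Rightarrow> 'p) \<Rightarrow> bool" where
  "poset_chain r t p \<longleftrightarrow> (\<forall>i. 1 \<le> i \<and> i < t \<longrightarrow> strictly r (p i) (p (i + 1)))"

definition poset_semichain :: "'p set \<Rightarrow> 'p rel \<Rightarrow> bool" where
  "poset_semichain P r \<longleftrightarrow>
     (\<exists>(s::nat) Q. P = (\<Union>i\<in>{1..s}. Q i) \<and> disjoint_family_on Q {1..s} \<and>
        (\<forall>i\<in>{1..s}. (\<exists>a. Q i = {a}) \<or>
           (\<exists>a b. Q i = {a, b} \<and> (a, b) \<notin> r \<and> (b, a) \<notin> r)) \<and>
        (\<forall>i. 1 \<le> i \<and> i < s \<longrightarrow> (\<forall>a\<in>Q i. \<forall>b\<in>Q (i + 1). strictly r a b)))"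


section \<open>Complex vector spaces\<close>

class complex_vector = ab_group_add +
  fixes scaleC :: "complex \<Rightarrow> 'a \<Rightarrow> 'a"  (infixr \<open>*\<^sub>C\<close> 75)
  assumes scaleC_add_right: "a *\<^sub>C (x + y) = a *\<^sub>C x + a *\<^sub>C y"
    and scaleC_add_left: "(a + b) *\<^sub>C x = a *\<^sub>C x + b *\<^sub>C x"
    and scaleC_scaleC: "a *\<^sub>C b *\<^sub>C x = (a * b) *\<^sub>C x"
    and scaleC_one: "1 *\<^sub>C x = x"

global_interpretation complex_vector: vector_space
  "scaleC :: complex \<Rightarrow> 'a \<Rightarrow> 'a::complex_vector"
  defines csubspace_raw_def: csubspace = complex_vector.subspace
    and cspan_raw_def: cspan = complex_vector.span
  by standard (rule scaleC_add_right scaleC_add_left scaleC_scaleC scaleC_one)+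

instantiation complex :: complex_vector
begin
definition scaleC_complex :: "complex \<Rightarrow> complex \<Rightarrow> complex" where "scaleC_complex c z = c * z"
instance by standard (auto simp: scaleC_complex_def algebra_simps)
end

instantiation "fun" :: (type, complex_vector) complex_vector
begin
definition scaleC_fun :: "complex \<Rightarrow> ('a \<Rightarrow> 'b) \<Rightarrow> 'a \<Rightarrow> 'b" where
  "scaleC_fun c f = (\<lambda>i. c *\<^sub>C f i)"
instance
  by standard (auto simp: scaleC_fun_def fun_eq_iff scaleC_add_right scaleC_add_left
      scaleC_scaleC scaleC_one)
end

instantiation prod :: (complex_vector, complex_vector) complex_vector
begin
definition scaleC_prod :: "complex \<Rightarrow> 'a \<times> 'b \<Rightarrow> 'a \<times> 'b" where
  "scaleC_prod c z = (c *\<^sub>C fst z, c *\<^sub>C snd z)"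
instance
  by standard (auto simp: scaleC_prod_def scaleC_add_right scaleC_add_left
      scaleC_scaleC scaleC_one)
end


section \<open>Unitary spaces and systems of subspaces\<close>

text \<open>
  The underlying space is a subspace of a type carrying a complex vector space structure
  (possibly all of it), so that spaces of varying dimension can live on one type; the scalar
  product is only relevant on the carrier. It is linear in its first argument and
  conjugate-linear in its second.
\<close>

record 'a inner_space =
  carr :: "'a set"
  ip :: "'a \<Rightarrow> 'a \<Rightarrow> complex"

record 'a subspace_system = "'a inner_space" +
  sub :: "nat \<Rightarrow> 'a set"

locale unitary_space =
  fixes V :: "('a::complex_vector, 'm) inner_space_scheme"
  assumes subspace_carr: "csubspace (carr V)"
    and finite_dim: "\<exists>B. finite B \<and> cspan B = carr V"
    and ip_add: "\<lbrakk>x \<in> carr V; y \<in> carr V; z \<in> carr V\<rbrakk> \<Longrightarrow> ip V (x + y) z = ip V x z + ip V y z"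
    and ip_scale: "\<lbrakk>x \<in> carr V; y \<in> carr V\<rbrakk> \<Longrightarrow> ip V (c *\<^sub>C x) y = c * ip V x y"
    and ip_cnj: "\<lbrakk>x \<in> carr V; y \<in> carr V\<rbrakk> \<Longrightarrow> ip V y x = cnj (ip V x y)"
    and ip_pos: "\<lbrakk>x \<in> carr V; x \<noteq> 0\<rbrakk> \<Longrightarrow> Re (ip V x x) > 0"

text \<open>The subspaces of a system are those at positions \<open>1, \<dots>, t\<close>; other positions are ignored.\<close>

definition P_system ::
  "'p rel \<Rightarrow> nat \<Rightarrow> (nat \<Rightarrow> 'p) \<Rightarrow> 'a::complex_vector subspace_system \<Rightarrow> bool" where
  "P_system r t p U \<longleftrightarrow>
     unitary_space U \<and>
     (\<forall>i\<in>{1..t}. csubspace (sub U i) \<and> sub U i \<subseteq> carr U) \<and>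
     (\<forall>i\<in>{1..t}. \<forall>j\<in>{1..t}. strictly r (p i) (p j) \<longrightarrow> sub U i \<subseteq> sub U j)"

definition isometric ::
  "nat \<Rightarrow> 'a::complex_vector subspace_system \<Rightarrow> 'b::complex_vector subspace_system \<Rightarrow> bool" where
  "isometric t U V \<longleftrightarrow>
     (\<exists>\<phi>. bij_betw \<phi> (carr U) (carr V) \<and>
        (\<forall>x\<in>carr U. \<forall>y\<in>carr U. \<phi> (x + y) = \<phi> x + \<phi> y) \<and>
        (\<forall>c. \<forall>x\<in>carr U. \<phi> (c *\<^sub>C x) = c *\<^sub>C \<phi> x) \<and>
        (\<forall>x\<in>carr U. \<forall>y\<in>carr U. ip V (\<phi> x) (\<phi> y) = ip U x y) \<and>
        (\<forall>i\<in>{1..t}. \<phi> ` sub U i = sub V i))"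


section \<open>Orthogonal direct sums\<close>

definition orth_sum2 ::
  "'a::complex_vector subspace_system \<Rightarrow> 'b::complex_vector subspace_system
     \<Rightarrow> ('a \<times> 'b) subspace_system" where
  "orth_sum2 U V = \<lparr>carr = carr U \<times> carr V,
     ip = (\<lambda>x y. ip U (fst x) (fst y) + ip V (snd x) (snd y)),
     sub = (\<lambda>i. sub U i \<times> sub V i)\<rparr>"

text \<open>
  The external orthogonal direct sum of a list of systems: vectors are the families
  \<open>x 0, \<dots>, x (n - 1)\<close> of vectors of the summands, extended by zero. The two lemmas below
  say that it is the iterated binary sum, the empty sum being the system on the zero space.
\<close>

definition families :: "'b::zero set list \<Rightarrow> (nat \<Rightarrow> 'b) set" where
  "families As = {x. (\<forall>i<length As. x i \<in> As ! i) \<and> (\<forall>i\<ge>length As. x i = 0)}"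

definition orth_sum :: "'a::complex_vector subspace_system list \<Rightarrow> (nat \<Rightarrow> 'a) subspace_system" where
  "orth_sum Us = \<lparr>carr = families (map carr Us),
     ip = (\<lambda>x y. \<Sum>i<length Us. ip (Us ! i) (x i) (y i)),
     sub = (\<lambda>j. families (map (\<lambda>U. sub U j) Us))\<rparr>"

lemma orth_sum_Nil: "carr (orth_sum []) = {0}" "sub (orth_sum []) j = {0}"
  by (auto simp: orth_sum_def families_def fun_eq_iff)

lemma families_Cons:
  "(\<lambda>x. (x 0, \<lambda>i. x (Suc i))) ` families (A # As) = A \<times> families As"
proof
  show "(\<lambda>x. (x 0, \<lambda>i. x (Suc i))) ` families (A # As) \<subseteq> A \<times> families As"
    by (fastforce simp: families_def)
next
  show "A \<times> families As \<subseteq> (\<lambda>x. (x 0, \<lambda>i. x (Suc i))) ` families (A # As)"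
  proof clarify
    fix a x assume "a \<in> A" "x \<in> families As"
    then have "case_nat a x \<in> families (A # As)"
      by (auto simp: families_def nth_Cons split: nat.split)
    then show "(a, x) \<in> (\<lambda>x. (x 0, \<lambda>i. x (Suc i))) ` families (A # As)"
      by (force intro: rev_image_eqI)
  qed
qed

lemma orth_sum_Cons: "isometric t (orth_sum (U # Us)) (orth_sum2 U (orth_sum Us))"
proof -
  define \<phi> :: "(nat \<Rightarrow> 'a) \<Rightarrow> 'a \<times> (nat \<Rightarrow> 'a)" where "\<phi> = (\<lambda>x. (x 0, \<lambda>i. x (Suc i)))"
  have "inj \<phi>"
  proof (rule injI)
    fix x y assume *: "\<phi> x = \<phi> y"
    have "x i = y i" for i
      using * by (cases i) (auto simp: \<phi>_def fun_eq_iff)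
    then show "x = y" by blast
  qed
  then have "bij_betw \<phi> (carr (orth_sum (U # Us))) (carr (orth_sum2 U (orth_sum Us)))"
    by (auto simp: bij_betw_def orth_sum_def orth_sum2_def \<phi>_def families_Cons intro: inj_on_subset)
  then show ?thesis
    unfolding isometric_def
    by (intro exI[of _ \<phi>])
      (auto simp: orth_sum_def orth_sum2_def \<phi>_def families_Cons scaleC_prod_def scaleC_fun_def
        plus_fun_def sum.lessThan_Suc_shift simp del: sum.lessThan_Suc)
qed


section \<open>The summands\<close>

text \<open>
  \<open>coord_space n\<close> with \<open>std_ip n\<close> is \<open>\<complex> \<bottom> \<dots> \<bottom> \<complex>\<close> (\<open>n\<close> terms); the coordinates of a
  vector are at positions \<open>0, \<dots>, n - 1\<close>.
\<close>

definition coord_space :: "nat \<Rightarrow> (nat \<Rightarrow> complex) set" where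
  "coord_space n = {x. \<forall>i\<ge>n. x i = 0}"

definition std_ip :: "nat \<Rightarrow> (nat \<Rightarrow> complex) \<Rightarrow> (nat \<Rightarrow> complex) \<Rightarrow> complex" where
  "std_ip n x y = (\<Sum>i<n. x i * cnj (y i))"

definition vec2 :: "complex \<Rightarrow> complex \<Rightarrow> nat \<Rightarrow> complex" where
  "vec2 a b = (\<lambda>i. if i = 0 then a else if i = 1 then b else 0)"

definition sysF :: "nat \<Rightarrow> (nat \<Rightarrow> complex) subspace_system" where
  "sysF k = \<lparr>carr = coord_space 1, ip = std_ip 1,
     sub = (\<lambda>j. if j < k then {0} else coord_space 1)\<rparr>"

definition sysF0 :: "(nat \<Rightarrow> complex) subspace_system" where
  "sysF0 = \<lparr>carr = coord_space 1, ip = std_ip 1, sub = (\<lambda>j. {0})\<rparr>"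

definition sysG_sigma :: "nat \<Rightarrow> real \<Rightarrow> (nat \<Rightarrow> complex) subspace_system" where
  "sysG_sigma k \<sigma> = \<lparr>carr = coord_space 2, ip = std_ip 2,
     sub = (\<lambda>j. if j < k then {0}
                else if j = k then cspan {vec2 1 0}
                else if j = k + 1 then cspan {vec2 (complex_of_real \<sigma>) 1}
                else coord_space 2)\<rparr>"

definition sysG :: "nat \<Rightarrow> (nat \<Rightarrow> complex) subspace_system" where
  "sysG k = \<lparr>carr = coord_space 1, ip = std_ip 1,
     sub = (\<lambda>j. if j < k then {0}
                else if j = k then coord_space 1
                else if j = k + 1 then {0}
                else coord_space 1)\<rparr>"

definition chain_summands :: "nat \<Rightarrow> (nat \<Rightarrow> complex) subspace_system set" where
  "chain_summands t = {sysF k | k. 1 \<le> k \<and> k \<le> t} \<union> {sysF0}"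

definition semichain_summands ::
  "'p rel \<Rightarrow> nat \<Rightarrow> (nat \<Rightarrow> 'p) \<Rightarrow> (nat \<Rightarrow> complex) subspace_system set" where
  "semichain_summands r t p = chain_summands t \<union>
     {sysG_sigma k \<sigma> | k \<sigma>. 1 \<le> k \<and> k < t \<and> \<not> strictly r (p k) (p (k + 1)) \<and> \<sigma> > 0} \<union>
     {sysG k | k. 1 \<le> k \<and> k < t \<and> \<not> strictly r (p k) (p (k + 1))}"

end

theory Submission
  imports Defs "HOL-Computational_Algebra.Fundamental_Theorem_Algebra"
begin

text \<open>
  A system is decomposed by splitting off one summand after another, and the multiplicity of
  each summand is read off from the system itself.

  Existence. Look at the first nonzero subspace \<open>A\<close>, at position \<open>k\<close>. In a semichain all later
  subspaces contain \<open>A\<close>, except possibly the next one, \<open>B\<close>. Unless \<open>p\<^sub>k\<close> and \<open>p\<^sub>k\<^sub>+\<^sub>1\<close> are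
  incomparable, any unit vector of \<open>A\<close> spans a line that splits off as a copy of
  \<open>F\<^sub>k\<close>. If they are incomparable, only the position of the pair \<open>A\<close>, \<open>B\<close> matters, as the
  remaining subspaces contain both. The operator \<open>P\<^sub>A P\<^sub>B\<close> on \<open>A\<close> has an eigenvector \<open>x\<close>
  (\<open>exists_principal_vector\<close>), and the span of \<open>x\<close> and \<open>P\<^sub>B x\<close>, of dimension one or two, splits
  off as a copy of \<open>F\<^sub>k\<close>, \<open>G\<^sub>k\<close> or \<open>G\<^sub>k\<^sub>,\<^sub>\<sigma>\<close>, with \<open>\<sigma>\<close> the cotangent of the angle between the two
  vectors (\<open>exists_reducing_frame\<close>, \<open>isometric_split_off\<close>). The orthogonal complement is a
  system of smaller dimension, and induction finishes the argument.

  Uniqueness. To every summand belongs a set of conditions on a vector (membership in some of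
  the subspaces, orthogonality to others, and for \<open>G\<^sub>k\<^sub>,\<^sub>\<sigma>\<close> being an eigenvector of
  \<open>P\<^sub>k P\<^sub>k\<^sub>+\<^sub>1\<close> for the squared cosine of the angle) that cuts out a line in that summand and
  zero in every other one (\<open>summand_separated\<close>). The vectors satisfying these conditions are
  compatible with isometries and with orthogonal sums, so the dimension of the space
  that they form in a system is the multiplicity of the summand in any decomposition
  (\<open>decomposition_unique\<close>).

  Chains are treated together with semichains: both satisfy \<open>semichain_gaps\<close>, and for a chain
  there are no incomparable neighbours, hence no summands \<open>G\<^sub>k\<close>, \<open>G\<^sub>k\<^sub>,\<^sub>\<sigma>\<close>.
\<close>


section \<open>Dimension, and maps linear on a subspace\<close>

text \<open>
  Being stated by a finite basis, this relation implies finite dimension, whereas the numerical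
  dimension of an infinite-dimensional space is a conventional value.
\<close>

definition has_dim :: "'a::complex_vector set \<Rightarrow> nat \<Rightarrow> bool" where
  "has_dim A n \<longleftrightarrow>
     (\<exists>B. finite B \<and> complex_vector.independent B \<and> card B = n \<and> cspan B = A)"

lemma has_dim_unique: "has_dim A m \<Longrightarrow> has_dim A n \<Longrightarrow> m = n"
  unfolding has_dim_def by (metis complex_vector.dim_eq_card)

lemma has_dim_zero: "has_dim {0} 0"
  unfolding has_dim_def
  by (rule exI[of _ "{}"]) (simp add: complex_vector.independent_empty)

text \<open>
  Isometries of systems are linear on a carrier only; outside of it they are arbitrary.
\<close>

definition linear_on :: "'a::complex_vector set \<Rightarrow> ('a \<Rightarrow> 'b::complex_vector) \<Rightarrow> bool" where
  "linear_on A f \<longleftrightarrow>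
     (\<forall>x\<in>A. \<forall>y\<in>A. f (x + y) = f x + f y) \<and> (\<forall>c. \<forall>x\<in>A. f (c *\<^sub>C x) = c *\<^sub>C f x)"

lemma linear_on_subset: "linear_on B f \<Longrightarrow> A \<subseteq> B \<Longrightarrow> linear_on A f"
  unfolding linear_on_def by blast

text \<open>
  The prescription of \<^term>\<open>f\<close> on a basis of \<^term>\<open>A\<close> extends to a map that is linear on the whole
  type, and this map agrees with \<^term>\<open>f\<close> on \<^term>\<open>A\<close>. Linear maps injective on a span carry bases to bases.
\<close>

lemma has_dim_image:
  fixes f :: "'a::complex_vector \<Rightarrow> 'b::complex_vector"
  assumes "has_dim A n" and lin: "linear_on A f" and inj: "inj_on f A"
  shows "has_dim (f ` A) n"
proof -
  interpret vector_space_pair "scaleC :: complex \<Rightarrow> 'a \<Rightarrow> 'a" "scaleC :: complex \<Rightarrow> 'b \<Rightarrow> 'b"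
    by standard
  obtain B where B: "finite B" "complex_vector.independent B" "card B = n" "cspan B = A"
    using assms(1) by (auto simp: has_dim_def)
  obtain g where g: "Vector_Spaces.linear (*\<^sub>C) (*\<^sub>C) g" "\<forall>x\<in>B. g x = f x"
    using linear_independent_extend[OF B(2)] by blast
  have BA: "B \<subseteq> A" using B(4) complex_vector.span_superset by blast
  have f0: "f 0 = 0"
  proof -
    have "0 \<in> A" using B(4) complex_vector.span_zero by blast
    then have "f (0 *\<^sub>C 0) = 0 *\<^sub>C f 0" using lin unfolding linear_on_def by blast
    then show ?thesis by (simp add: complex_vector.scale_zero_left)
  qed
  have "csubspace A" using complex_vector.subspace_span[of B] B(4) by simp
  have "x \<in> A \<and> g x = f x" if "x \<in> cspan B" for x
    using that
  proof (induction rule: complex_vector.span_induct_alt)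
    case base
    show ?case using linear_0[OF g(1)] f0 complex_vector.subspace_0[OF \<open>csubspace A\<close>] by simp
  next
    case (step c x y)
    then have xy: "x \<in> A" "y \<in> A" "c *\<^sub>C x \<in> A"
      using BA complex_vector.subspace_scale[OF \<open>csubspace A\<close>] by auto
    have "g (c *\<^sub>C x + y) = c *\<^sub>C g x + g y"
      by (simp add: linear_add[OF g(1)] linear_scale[OF g(1)])
    also have "\<dots> = f (c *\<^sub>C x + y)"
      using lin xy step g(2) by (simp add: linear_on_def)
    finally show ?case
      using xy complex_vector.subspace_add[OF \<open>csubspace A\<close>] by auto
  qed
  then have eq: "g x = f x" if "x \<in> cspan B" for x using that by blast
  have "inj_on g (cspan B)" using inj eq B(4) by (auto simp: inj_on_def)
  then have "complex_vector.independent (g ` B)"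
    using linear_independent_injective_image[OF g(1) B(2)] unfolding cspan_raw_def by blast
  moreover have "cspan (g ` B) = f ` A"
    using linear_span_image[OF g(1), of B] eq B(4) by (simp flip: cspan_raw_def cong: image_cong)
  moreover have "card (g ` B) = n"
    using \<open>inj_on g (cspan B)\<close> BA B by (metis card_image inj_on_subset)
  ultimately show ?thesis unfolding has_dim_def using B(1) by blast
qed

lemma linear_on_Pair_0: "linear_on A (Pair 0)"
  by (auto simp: linear_on_def scaleC_prod_def complex_vector.scale_zero_right)

lemma has_dim_zero_Times:
  fixes A :: "'b::complex_vector set"
  assumes "has_dim A n" shows "has_dim ({0::'a::complex_vector} \<times> A) n"
proof -
  have "Pair (0::'a) ` A = {0} \<times> A" by auto
  moreover have "inj_on (Pair (0::'a)) A" by (auto simp: inj_on_def)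
  ultimately show ?thesis
    using has_dim_image[OF assms linear_on_Pair_0[where 'b='a]] by auto
qed

text \<open>
  This is the one case of additivity of the dimension that counting summands needs: each
  summand contributes either nothing or a line. A basis of \<^term>\<open>{0} \<times> A\<close> is extended by
  \<^term>\<open>(a, 0)\<close>.
\<close>

lemma has_dim_line_Times:
  fixes a :: "'a::complex_vector" and A :: "'b::complex_vector set"
  assumes "has_dim A n" "a \<noteq> 0"
  shows "has_dim (cspan {a} \<times> A) (Suc n)"
proof -
  obtain B where B: "finite B" "complex_vector.independent B" "card B = n" "cspan B = {0::'a} \<times> A"
    using has_dim_zero_Times[OF assms(1)] unfolding has_dim_def by blast
  have a: "(a, 0) \<notin> cspan B" using assms(2) B(4) by auto
  then have "complex_vector.independent (insert (a, 0) B)" "(a, 0) \<notin> B"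
    using B complex_vector.independent_insertI complex_vector.span_base by blast+
  moreover have "cspan (insert (a, 0) B) = cspan {a} \<times> A"
    unfolding complex_vector.span_insert B(4) complex_vector.span_empty
    by (auto simp: scaleC_prod_def complex_vector.scale_zero_right)
  ultimately show ?thesis unfolding has_dim_def using B(1,3)
    by (intro exI[of _ "insert (a, 0) B"]) auto
qed


section \<open>Isometries and configurations of subspaces\<close>

definition isometry_via ::
  "nat \<Rightarrow> 'a::complex_vector subspace_system \<Rightarrow> 'b::complex_vector subspace_system
     \<Rightarrow> ('a \<Rightarrow> 'b) \<Rightarrow> bool" where
  "isometry_via t U V \<phi> \<longleftrightarrow>
     bij_betw \<phi> (carr U) (carr V) \<and> linear_on (carr U) \<phi> \<and>
     (\<forall>x\<in>carr U. \<forall>y\<in>carr U. ip V (\<phi> x) (\<phi> y) = ip U x y) \<and>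
     (\<forall>i\<in>{1..t}. \<phi> ` sub U i = sub V i)"

lemma isometric_iff: "isometric t U V \<longleftrightarrow> (\<exists>\<phi>. isometry_via t U V \<phi>)"
  unfolding isometric_def isometry_via_def linear_on_def by auto

text \<open>
  These are the properties shared by \<open>P\<close>-systems, by the standard summands and by orthogonal
  sums of either that make isotypic parts, defined below, transport along isometries and
  split along sums. They pass from the summands to a sum coordinate by coordinate.
\<close>

definition configuration :: "nat \<Rightarrow> 'a::complex_vector subspace_system \<Rightarrow> bool" where
  "configuration t U \<longleftrightarrow> csubspace (carr U) \<and> (\<forall>x\<in>carr U. ip U x 0 = 0) \<and>
     (\<forall>i\<in>{1..t}. csubspace (sub U i) \<and> sub U i \<subseteq> carr U)"

lemma isometric_trans:
  assumes "isometric t U V" "isometric t V W" "\<forall>i\<in>{1..t}. sub U i \<subseteq> carr U"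
  shows "isometric t U W"
proof -
  obtain f g where f: "isometry_via t U V f" and g: "isometry_via t V W g"
    using assms by (auto simp: isometric_iff)
  have fc: "f x \<in> carr V" if "x \<in> carr U" for x
    using f that by (auto simp: isometry_via_def bij_betw_def)
  have "isometry_via t U W (g \<circ> f)"
    unfolding isometry_via_def
  proof (intro conjI)
    show "bij_betw (g \<circ> f) (carr U) (carr W)"
      using f g by (auto simp: isometry_via_def intro: bij_betw_trans)
    show "linear_on (carr U) (g \<circ> f)"
      using f g fc by (auto simp: isometry_via_def linear_on_def)
    show "\<forall>x\<in>carr U. \<forall>y\<in>carr U. ip W ((g \<circ> f) x) ((g \<circ> f) y) = ip U x y"
      using f g fc by (auto simp: isometry_via_def)
    show "\<forall>i\<in>{1..t}. (g \<circ> f) ` sub U i = sub W i"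
      using f g by (simp add: isometry_via_def flip: image_image)
  qed
  then show ?thesis by (auto simp: isometric_iff)
qed

lemma isometric_sym:
  assumes "isometric t U V" "configuration t U"
  shows "isometric t V U"
proof -
  obtain f where f: "isometry_via t U V f"
    using assms by (auto simp: isometric_iff)
  define g where "g = inv_into (carr U) f"
  have bij: "bij_betw f (carr U) (carr V)" using f by (auto simp: isometry_via_def)
  have gf: "g (f x) = x" if "x \<in> carr U" for x
    using bij that by (auto simp: g_def bij_betw_def)
  have V: "carr V = f ` carr U" using bij by (auto simp: bij_betw_def)
  have add: "x + y \<in> carr U" if "x \<in> carr U" "y \<in> carr U" for x y
    using assms(2) that by (auto simp: configuration_def complex_vector.subspace_add)
  have sc: "c *\<^sub>C x \<in> carr U" if "x \<in> carr U" for c x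
    using assms(2) that by (auto simp: configuration_def complex_vector.subspace_scale)
  have "isometry_via t V U g"
    unfolding isometry_via_def
  proof (intro conjI)
    show "bij_betw g (carr V) (carr U)"
      using bij by (simp add: g_def bij_betw_inv_into)
    show "linear_on (carr V) g"
      unfolding linear_on_def
    proof (intro conjI ballI allI)
      fix x y assume "x \<in> carr V" "y \<in> carr V"
      then obtain a b where ab: "x = f a" "y = f b" "a \<in> carr U" "b \<in> carr U" using V by auto
      then have "x + y = f (a + b)" using f by (auto simp: isometry_via_def linear_on_def)
      then show "g (x + y) = g x + g y" using ab gf add by simp
    next
      fix c x assume "x \<in> carr V"
      then obtain a where ab: "x = f a" "a \<in> carr U" using V by auto
      then have "c *\<^sub>C x = f (c *\<^sub>C a)" using f by (auto simp: isometry_via_def linear_on_def)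
      then show "g (c *\<^sub>C x) = c *\<^sub>C g x" using ab gf sc by simp
    qed
    show "\<forall>x\<in>carr V. \<forall>y\<in>carr V. ip U (g x) (g y) = ip V x y"
      using f gf by (auto simp: isometry_via_def V)
    show "\<forall>i\<in>{1..t}. g ` sub V i = sub U i"
    proof
      fix i assume i: "i \<in> {1..t}"
      then have "sub V i = f ` sub U i" "sub U i \<subseteq> carr U"
        using f assms(2) by (auto simp: isometry_via_def configuration_def)
      then show "g ` sub V i = sub U i" using gf by (force simp: image_iff)
    qed
  qed
  then show ?thesis by (auto simp: isometric_iff)
qed

lemma isometric_orth_sum2:
  assumes "isometric t V W"
  shows "isometric t (orth_sum2 S V) (orth_sum2 S W)"
proof -
  obtain f where f: "isometry_via t V W f"
    using assms by (auto simp: isometric_iff)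
  have "isometry_via t (orth_sum2 S V) (orth_sum2 S W) (map_prod id f)"
    unfolding isometry_via_def
  proof (intro conjI)
    show "bij_betw (map_prod id f) (carr (orth_sum2 S V)) (carr (orth_sum2 S W))"
      using f by (auto simp: isometry_via_def orth_sum2_def intro: bij_betw_map_prod)
    show "linear_on (carr (orth_sum2 S V)) (map_prod id f)"
      using f by (auto simp: isometry_via_def linear_on_def orth_sum2_def scaleC_prod_def)
    show "\<forall>x\<in>carr (orth_sum2 S V). \<forall>y\<in>carr (orth_sum2 S V).
        ip (orth_sum2 S W) (map_prod id f x) (map_prod id f y) = ip (orth_sum2 S V) x y"
      using f by (auto simp: isometry_via_def orth_sum2_def)
    show "\<forall>i\<in>{1..t}. map_prod id f ` sub (orth_sum2 S V) i = sub (orth_sum2 S W) i"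
      using f by (simp add: isometry_via_def orth_sum2_def map_prod_surj_on)
  qed
  then show ?thesis by (auto simp: isometric_iff)
qed


section \<open>Isotypic parts\<close>

text \<open>
  A vector belongs to this part if it lies in the subspaces indexed by \<^term>\<open>I\<close>, is orthogonal to
  those indexed by \<^term>\<open>J\<close>, and, with \<open>P\<^sub>k\<close> the orthogonal projection onto the \<open>k\<close>-th subspace,
  satisfies \<open>P\<^sub>k P\<^sub>k\<^sub>+\<^sub>1 x = l x\<close> for \<open>k \<in> K\<close> (the vector \<open>y\<close> being \<open>P\<^sub>k\<^sub>+\<^sub>1 x\<close>; the equation has this
  meaning when \<open>x\<close> lies in the \<open>k\<close>-th subspace, which is ensured by \<open>K \<subseteq> I\<close> wherever
  \<open>K\<close> is nonempty). For each standard summand there is a choice of \<open>I\<close>, \<open>J\<close>, \<open>K\<close>, \<open>l\<close> for which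
  this part is a line in that summand and zero in every other one. Its dimension then counts
  the occurrences of the summand.
\<close>

definition isotypic_part ::
  "nat set \<Rightarrow> nat set \<Rightarrow> nat set \<Rightarrow> complex \<Rightarrow> 'a::complex_vector subspace_system \<Rightarrow> 'a set" where
  "isotypic_part I J K l U = {x \<in> carr U.
     (\<forall>i\<in>I. x \<in> sub U i) \<and>
     (\<forall>j\<in>J. \<forall>u\<in>sub U j. ip U x u = 0) \<and>
     (\<forall>k\<in>K. \<exists>y\<in>sub U (k + 1).
        (\<forall>u\<in>sub U (k + 1). ip U (x - y) u = 0) \<and> (\<forall>u\<in>sub U k. ip U (y - l *\<^sub>C x) u = 0))}"

lemma linear_on_diff:
  assumes "linear_on A f" "csubspace A" "x \<in> A" "y \<in> A"
  shows "f (x - y) = f x - f y"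
proof -
  have "f x = f (x - y) + f y"
    using assms complex_vector.subspace_diff[OF assms(2,3,4)]
    by (metis diff_add_cancel linear_on_def)
  then show ?thesis by simp
qed

text \<open>
  All conditions in the definition are phrased by membership, linear combinations and scalar
  products, and an isometry preserves each of them in both directions.
\<close>

lemma isotypic_part_isometry:
  assumes U: "configuration t U" and f: "isometry_via t U V f"
    and I: "I \<subseteq> {1..t}" and J: "J \<subseteq> {1..t}" and K: "K \<subseteq> {1..<t}"
  shows "isotypic_part I J K l V = f ` isotypic_part I J K l U"
proof -
  have V: "carr V = f ` carr U" and inj: "inj_on f (carr U)"
    using f by (auto simp: isometry_via_def bij_betw_def)
  have S: "sub V i = f ` sub U i" "sub U i \<subseteq> carr U" if "i \<in> {1..t}" for i
    using that f U by (auto simp: isometry_via_def configuration_def)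
  have ip: "ip V (f x) (f y) = ip U x y" if "x \<in> carr U" "y \<in> carr U" for x y
    using that f by (auto simp: isometry_via_def)
  have c: "csubspace (carr U)" and lin: "linear_on (carr U) f"
    using U f by (auto simp: configuration_def isometry_via_def)
  have mem: "f x \<in> sub V i \<longleftrightarrow> x \<in> sub U i" if "i \<in> {1..t}" "x \<in> carr U" for i x
    using S[OF that(1)] that(2) inj by (auto simp: inj_on_def)
  have orth: "(\<forall>u\<in>sub V i. ip V (f x) u = 0) \<longleftrightarrow> (\<forall>u\<in>sub U i. ip U x u = 0)"
    if "i \<in> {1..t}" "x \<in> carr U" for i x
    using S[OF that(1)] ip[OF that(2)] by (simp add: subset_iff)
  have *: "f x \<in> isotypic_part I J K l V \<longleftrightarrow> x \<in> isotypic_part I J K l U" if x: "x \<in> carr U" for x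
  proof -
    have "(\<exists>y\<in>sub V (k + 1). (\<forall>u\<in>sub V (k + 1). ip V (f x - y) u = 0) \<and>
              (\<forall>u\<in>sub V k. ip V (y - l *\<^sub>C f x) u = 0)) \<longleftrightarrow>
          (\<exists>y\<in>sub U (k + 1). (\<forall>u\<in>sub U (k + 1). ip U (x - y) u = 0) \<and>
              (\<forall>u\<in>sub U k. ip U (y - l *\<^sub>C x) u = 0))" if k: "k \<in> K" for k
    proof -
      have kt: "k \<in> {1..t}" "k + 1 \<in> {1..t}" using k K by auto
      have "((\<forall>u\<in>sub V (k + 1). ip V (f x - f y) u = 0) \<and>
              (\<forall>u\<in>sub V k. ip V (f y - l *\<^sub>C f x) u = 0)) \<longleftrightarrow>
            ((\<forall>u\<in>sub U (k + 1). ip U (x - y) u = 0) \<and>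
              (\<forall>u\<in>sub U k. ip U (y - l *\<^sub>C x) u = 0))" if "y \<in> sub U (k + 1)" for y
      proof -
        have y: "y \<in> carr U" using S(2)[OF kt(2)] that by auto
        have lx: "l *\<^sub>C x \<in> carr U" using c x by (rule complex_vector.subspace_scale)
        have "f x - f y = f (x - y)" "f y - l *\<^sub>C f x = f (y - l *\<^sub>C x)"
          using linear_on_diff[OF lin c] x y lx lin by (auto simp: linear_on_def)
        moreover have "x - y \<in> carr U" "y - l *\<^sub>C x \<in> carr U"
          using c x y lx complex_vector.subspace_diff by blast+
        ultimately show ?thesis using orth kt by simp
      qed
      then show ?thesis using S(1)[OF kt(2)] by simp
    qed
    then show ?thesis
      using I J mem orth x V unfolding isotypic_part_def by (auto simp: subset_iff)
  qed
  have "isotypic_part I J K l V \<subseteq> carr V" "isotypic_part I J K l U \<subseteq> carr U"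
    by (auto simp: isotypic_part_def)
  then show ?thesis using * V by fastforce
qed

lemma bex_Times_conj:
  assumes "C = A \<times> B" "\<And>y z. y \<in> A \<Longrightarrow> z \<in> B \<Longrightarrow> R (y, z) \<longleftrightarrow> P y \<and> Q z"
  shows "(\<exists>w\<in>C. R w) \<longleftrightarrow> (\<exists>y\<in>A. P y) \<and> (\<exists>z\<in>B. Q z)"
  using assms by auto

text \<open>
  Orthogonality to a product of subspaces is orthogonality in each coordinate: the nontrivial
  direction tests against vectors with one coordinate equal to zero.
\<close>

lemma isotypic_part_orth_sum2:
  assumes U: "configuration t U" and V: "configuration t V"
    and I: "I \<subseteq> {1..t}" and J: "J \<subseteq> {1..t}" and K: "K \<subseteq> {1..<t}"
  shows "isotypic_part I J K l (orth_sum2 U V) = isotypic_part I J K l U \<times> isotypic_part I J K l V"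
proof -
  have orth: "(\<forall>u\<in>sub (orth_sum2 U V) i. ip (orth_sum2 U V) (a, b) u = 0) \<longleftrightarrow>
      (\<forall>u\<in>sub U i. ip U a u = 0) \<and> (\<forall>u\<in>sub V i. ip V b u = 0)"
    if "i \<in> {1..t}" "a \<in> carr U" "b \<in> carr V" for i a b
  proof -
    have z: "0 \<in> sub U i" "0 \<in> sub V i" "ip U a 0 = 0" "ip V b 0 = 0"
      using U V that by (auto simp: configuration_def complex_vector.subspace_0)
    then show ?thesis by (force simp: orth_sum2_def)
  qed
  have sub: "sub (orth_sum2 U V) i = sub U i \<times> sub V i" "carr (orth_sum2 U V) = carr U \<times> carr V" for i
    by (auto simp: orth_sum2_def)
  have "(a, b) \<in> isotypic_part I J K l (orth_sum2 U V) \<longleftrightarrow>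
      a \<in> isotypic_part I J K l U \<and> b \<in> isotypic_part I J K l V"
    if ab: "a \<in> carr U" "b \<in> carr V" for a b
  proof -
    have "(\<exists>y\<in>sub (orth_sum2 U V) (k + 1).
            (\<forall>u\<in>sub (orth_sum2 U V) (k + 1). ip (orth_sum2 U V) ((a, b) - y) u = 0) \<and>
            (\<forall>u\<in>sub (orth_sum2 U V) k. ip (orth_sum2 U V) (y - l *\<^sub>C (a, b)) u = 0)) \<longleftrightarrow>
          (\<exists>y\<in>sub U (k + 1). (\<forall>u\<in>sub U (k + 1). ip U (a - y) u = 0) \<and>
              (\<forall>u\<in>sub U k. ip U (y - l *\<^sub>C a) u = 0)) \<and>
          (\<exists>y\<in>sub V (k + 1). (\<forall>u\<in>sub V (k + 1). ip V (b - y) u = 0) \<and>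
              (\<forall>u\<in>sub V k. ip V (y - l *\<^sub>C b) u = 0))" if k: "k \<in> K" for k
    proof (rule bex_Times_conj[OF sub(1)])
      have kt: "k \<in> {1..t}" "k + 1 \<in> {1..t}" using k K by auto
      fix y z assume that: "y \<in> sub U (k + 1)" "z \<in> sub V (k + 1)"
      show "((\<forall>u\<in>sub (orth_sum2 U V) (k + 1). ip (orth_sum2 U V) ((a, b) - (y, z)) u = 0) \<and>
            (\<forall>u\<in>sub (orth_sum2 U V) k. ip (orth_sum2 U V) ((y, z) - l *\<^sub>C (a, b)) u = 0)) \<longleftrightarrow>
         ((\<forall>u\<in>sub U (k + 1). ip U (a - y) u = 0) \<and> (\<forall>u\<in>sub U k. ip U (y - l *\<^sub>C a) u = 0)) \<and>
         ((\<forall>u\<in>sub V (k + 1). ip V (b - z) u = 0) \<and> (\<forall>u\<in>sub V k. ip V (z - l *\<^sub>C b) u = 0))"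
      proof -
        have yz: "y \<in> carr U" "z \<in> carr V" "csubspace (carr U)" "csubspace (carr V)"
          using U V that kt by (auto simp: configuration_def)
        then have "a - y \<in> carr U" "b - z \<in> carr V" "y - l *\<^sub>C a \<in> carr U" "z - l *\<^sub>C b \<in> carr V"
          using ab by (auto intro: complex_vector.subspace_diff complex_vector.subspace_scale)
        then show ?thesis using orth[OF kt(1)] orth[OF kt(2)] by (auto simp: scaleC_prod_def)
      qed
    qed
    then show ?thesis
      using I J orth ab unfolding isotypic_part_def by (auto simp: subset_iff sub)
  qed
  moreover have "isotypic_part I J K l (orth_sum2 U V) \<subseteq> carr U \<times> carr V"
      "isotypic_part I J K l U \<subseteq> carr U" "isotypic_part I J K l V \<subseteq> carr V"
    by (auto simp: isotypic_part_def sub)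
  ultimately show ?thesis by blast
qed

lemma configuration_orth_sum:
  assumes "\<forall>S\<in>set Ss. configuration t S"
  shows "configuration t (orth_sum Ss)"
proof -
  have fam: "csubspace (families As)" if "\<forall>i<length As. csubspace (As ! i)" for As :: "'a set list"
    using that
    by (intro complex_vector.subspaceI)
      (auto simp: families_def scaleC_fun_def complex_vector.subspace_0
        complex_vector.subspace_add complex_vector.subspace_scale complex_vector.scale_zero_right)
  have mono: "families (map f Ss) \<subseteq> families (map g Ss)" if "\<forall>S\<in>set Ss. f S \<subseteq> g S"
    for f g :: "'a subspace_system \<Rightarrow> 'a set"
    using that by (fastforce simp: families_def)
  show ?thesis
    unfolding configuration_def
  proof (intro conjI ballI)
    show "csubspace (carr (orth_sum Ss))"
      using assms by (auto simp: orth_sum_def configuration_def intro!: fam)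
    fix x assume "x \<in> carr (orth_sum Ss)"
    then show "ip (orth_sum Ss) x 0 = 0"
      using assms by (auto simp: orth_sum_def configuration_def families_def intro!: sum.neutral)
  next
    fix i assume "i \<in> {1..t}"
    then show "csubspace (sub (orth_sum Ss) i)" "sub (orth_sum Ss) i \<subseteq> carr (orth_sum Ss)"
      using assms fam mono[of "\<lambda>S. sub S i" carr] by (auto simp: orth_sum_def configuration_def)
  qed
qed

lemma configuration_orth_sum2:
  assumes U: "configuration t U" and V: "configuration t V"
  shows "configuration t (orth_sum2 U V)"
proof -
  have Times: "csubspace (A \<times> B)" if "csubspace A" "csubspace B"
    for A :: "'a set" and B :: "'b set"
    using that
    by (intro complex_vector.subspaceI)
      (auto simp: zero_prod_def scaleC_prod_def complex_vector.subspace_0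
        complex_vector.subspace_add complex_vector.subspace_scale)
  then show ?thesis
    using U V by (fastforce simp: configuration_def orth_sum2_def)
qed

text \<open>
  The isotypic part of a sum is, up to an isometry, the product of those of the summands, so
  each occurrence of \<^term>\<open>T\<close> raises the dimension by one and no other summand changes it.
\<close>

lemma has_dim_isotypic_part_orth_sum:
  assumes IJK: "I \<subseteq> {1..t}" "J \<subseteq> {1..t}" "K \<subseteq> {1..<t}"
    and Ss: "\<forall>S\<in>set Ss. configuration t S \<and>
      (if S = T then \<exists>a. a \<noteq> 0 \<and> isotypic_part I J K l S = cspan {a} else isotypic_part I J K l S = {0})"
  shows "has_dim (isotypic_part I J K l (orth_sum Ss)) (count (mset Ss) T)"
  using Ss
proof (induction Ss)
  case Nil
  have "isotypic_part I J K l (orth_sum ([] :: 'a subspace_system list)) = {0}"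
  proof -
    have [simp]: "families [] = {0 :: nat \<Rightarrow> 'a}" by (auto simp: families_def)
    show ?thesis
      by (auto simp: isotypic_part_def orth_sum_def)
  qed
  then show ?case by (simp add: has_dim_zero)
next
  case (Cons S Ss)
  have conf: "configuration t S" "configuration t (orth_sum Ss)"
      "configuration t (orth_sum (S # Ss))"
    using Cons.prems configuration_orth_sum[of Ss t] configuration_orth_sum[of "S # Ss" t] by auto
  obtain f where f: "isometry_via t (orth_sum2 S (orth_sum Ss)) (orth_sum (S # Ss)) f"
    using isometric_sym[OF orth_sum_Cons conf(3)] by (auto simp: isometric_iff)
  have eq: "isotypic_part I J K l (orth_sum (S # Ss)) =
      f ` (isotypic_part I J K l S \<times> isotypic_part I J K l (orth_sum Ss))"
    using isotypic_part_isometry[OF configuration_orth_sum2[OF conf(1,2)] f IJK]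
      isotypic_part_orth_sum2[OF conf(1,2) IJK] by simp
  have "isotypic_part I J K l S \<times> isotypic_part I J K l (orth_sum Ss)
      \<subseteq> carr (orth_sum2 S (orth_sum Ss))"
    by (auto simp: isotypic_part_def orth_sum2_def)
  then have "linear_on (isotypic_part I J K l S \<times> isotypic_part I J K l (orth_sum Ss)) f"
    and "inj_on f (isotypic_part I J K l S \<times> isotypic_part I J K l (orth_sum Ss))"
    using f linear_on_subset inj_on_subset by (auto simp: isometry_via_def bij_betw_def)
  moreover have "has_dim (isotypic_part I J K l S \<times> isotypic_part I J K l (orth_sum Ss))
      (count (mset (S # Ss)) T)"
  proof -
    have IH: "has_dim (isotypic_part I J K l (orth_sum Ss)) (count (mset Ss) T)"
      using Cons by simp
    show ?thesis
    proof (cases "S = T")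
      case True
      then obtain a where "a \<noteq> 0" "isotypic_part I J K l S = cspan {a}"
        using Cons.prems by auto
      then show ?thesis using has_dim_line_Times[OF IH] True by simp
    next
      case False
      then have "isotypic_part I J K l S = {0}" using Cons.prems by auto
      then show ?thesis using has_dim_zero_Times[OF IH] False by simp
    qed
  qed
  ultimately show ?case unfolding eq by (rule has_dim_image[rotated])
qed

text \<open>
  When this holds for all standard summands \<^term>\<open>S\<close>, the dimension of the isotypic part given by
  \<^term>\<open>I\<close>, \<^term>\<open>J\<close>, \<^term>\<open>K\<close>, \<^term>\<open>l\<close> is the multiplicity of \<^term>\<open>T\<close>.
\<close>

definition separates ::
  "nat set \<Rightarrow> nat set \<Rightarrow> nat set \<Rightarrow> complex \<Rightarrow> 'a::complex_vector subspace_system \<Rightarrow>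
     'a subspace_system \<Rightarrow> bool" where
  "separates I J K l T S \<longleftrightarrow>
    (if S = T then \<exists>a. a \<noteq> 0 \<and> isotypic_part I J K l S = cspan {a}
     else isotypic_part I J K l S = {0})"


section \<open>Isotypic parts of the standard summands\<close>

lemma coord_space_subspace: "csubspace (coord_space n)"
  by (intro complex_vector.subspaceI) (auto simp: coord_space_def scaleC_fun_def scaleC_complex_def)

lemma std_ip_self_eq_0:
  assumes "x \<in> coord_space n" "std_ip n x x = 0"
  shows "x = 0"
proof -
  have "std_ip n x x = of_real (\<Sum>i<n. (cmod (x i))\<^sup>2)"
    by (simp add: std_ip_def flip: complex_norm_square)
  then have "(\<Sum>i<n. (cmod (x i))\<^sup>2) = 0" using assms(2) of_real_eq_0_iff by metis
  then have "\<forall>i<n. x i = 0" by (subst (asm) sum_nonneg_eq_0_iff) auto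
  then have "x i = 0" for i using assms(1) by (cases "i < n") (auto simp: coord_space_def)
  then show ?thesis by (auto simp: fun_eq_iff)
qed

lemma vec2_apply [simp]: "vec2 a b 0 = a" "vec2 a b (Suc 0) = b"
  by (auto simp: vec2_def)

lemma vec2_in_coord_space: "vec2 a b \<in> coord_space 2"
  by (auto simp: vec2_def coord_space_def)

lemma scaleC_vec2: "c *\<^sub>C vec2 a b = vec2 (c * a) (c * b)"
  by (auto simp: scaleC_fun_def vec2_def scaleC_complex_def)

lemma cspan_vec2: "cspan {vec2 a b} = range (\<lambda>c. vec2 (c * a) (c * b))"
  unfolding complex_vector.span_singleton scaleC_vec2 ..

lemma coord_space_1: "coord_space 1 = cspan {vec2 1 0}"
  unfolding cspan_vec2
proof (intro equalityI subsetI)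
  fix x :: "nat \<Rightarrow> complex" assume "x \<in> coord_space 1"
  then have "x = vec2 (x 0 * 1) (x 0 * 0)" by (auto simp: coord_space_def vec2_def)
  then show "x \<in> range (\<lambda>c. vec2 (c * 1) (c * 0))" by blast
qed (auto simp: coord_space_def vec2_def)

lemma coord_space_2_cases:
  assumes "x \<in> coord_space 2" obtains a b where "x = vec2 a b"
proof
  show "x = vec2 (x 0) (x 1)" using assms by (auto simp: coord_space_def vec2_def)
qed

lemma std_ip_2: "std_ip 2 x y = x 0 * cnj (y 0) + x 1 * cnj (y 1)"
  by (simp add: std_ip_def numeral_2_eq_2)

lemma vec2_eq_iff: "vec2 a b = vec2 c d \<longleftrightarrow> a = c \<and> b = d"
  by (metis vec2_apply)

lemma vec2_0: "vec2 0 0 = 0"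
  by (auto simp: vec2_def)

lemma vec2_diff: "vec2 a b - vec2 c d = vec2 (a - c) (b - d)"
  by (auto simp: vec2_def)

lemmas summand_defs = sysF_def sysF0_def sysG_def sysG_sigma_def

lemma configuration_summand:
  assumes "S \<in> semichain_summands r t p"
  shows "configuration t S"
proof -
  have "csubspace {0 :: nat \<Rightarrow> complex}" by (rule complex_vector.subspace_single_0)
  moreover have "0 \<in> coord_space n" for n by (simp add: coord_space_def)
  moreover have "x \<in> cspan {vec2 a b} \<Longrightarrow> x \<in> coord_space 2" for x a b
    by (auto simp: cspan_vec2 vec2_in_coord_space)
  ultimately show ?thesis
    using assms coord_space_subspace
    by (auto simp: semichain_summands_def chain_summands_def configuration_def summand_defs
        std_ip_def complex_vector.subspace_span split: if_splits)
qed

context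
  fixes S :: "(nat \<Rightarrow> complex) subspace_system" and n
  assumes S: "carr S = coord_space n" "ip S = std_ip n"
begin

lemma isotypic_part_zero_mem:
  assumes "\<And>i. 0 \<in> sub S i" shows "0 \<in> isotypic_part I J K l S"
  using assms S
  by (auto simp: isotypic_part_def coord_space_def std_ip_def scaleC_fun_def scaleC_complex_def
      intro!: bexI[of _ 0])

lemma isotypic_part_orthogonal_member:
  "x \<in> isotypic_part I J K l S \<Longrightarrow> j \<in> J \<Longrightarrow> x \<in> sub S j \<Longrightarrow> x = 0"
  using S by (auto simp: isotypic_part_def intro: std_ip_self_eq_0)

text \<open>
  If the \<open>k\<close>-th subspace lies in the next one, then \<open>P\<^sub>k P\<^sub>k\<^sub>+\<^sub>1\<close> is the identity on it, and its only
  eigenvalue is 1.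
\<close>

lemma isotypic_part_nested:
  assumes x: "x \<in> isotypic_part I J K l S" and k: "k \<in> K" "k \<in> I"
    and sub: "sub S k \<subseteq> sub S (k + 1)" "csubspace (sub S (k + 1))" "sub S (k + 1) \<subseteq> coord_space n"
    and l: "l \<noteq> 1"
  shows "x = 0"
proof -
  have xk: "x \<in> sub S k" "x \<in> coord_space n" using x k S by (auto simp: isotypic_part_def)
  obtain y where y: "y \<in> sub S (k + 1)" "\<forall>u\<in>sub S (k + 1). std_ip n (x - y) u = 0"
      "\<forall>u\<in>sub S k. std_ip n (y - l *\<^sub>C x) u = 0"
    using x k S by (auto simp: isotypic_part_def)
  have "x - y \<in> sub S (k + 1)" using xk sub y complex_vector.subspace_diff by blast
  then have "x - y = 0" using y(2) sub(3) std_ip_self_eq_0 by blast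
  then have "std_ip n (x - l *\<^sub>C x) x = 0" using y xk by simp
  moreover have "std_ip n (x - l *\<^sub>C x) x = (1 - l) * std_ip n x x"
    by (simp add: std_ip_def scaleC_fun_def scaleC_complex_def sum_distrib_left algebra_simps)
  ultimately show ?thesis using l xk std_ip_self_eq_0 by auto
qed

end

lemma isotypic_part_sub_mem: "x \<in> isotypic_part I J K l S \<Longrightarrow> i \<in> I \<Longrightarrow> x \<in> sub S i"
  by (simp add: isotypic_part_def)

lemma isotypic_part_orth:
  "x \<in> isotypic_part I J K l S \<Longrightarrow> j \<in> J \<Longrightarrow> u \<in> sub S j \<Longrightarrow> ip S x u = 0"
  by (simp add: isotypic_part_def)

lemma sub_sysG_sigma:
  "sub (sysG_sigma m s) m = range (\<lambda>c. vec2 c 0)"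
  "sub (sysG_sigma m s) (m + 1) = range (\<lambda>c. vec2 (c * complex_of_real s) c)"
  by (simp_all add: sysG_sigma_def cspan_vec2)

lemma isotypic_part_sysG_sigma_orth:
  assumes x: "x \<in> isotypic_part I J K l (sysG_sigma m s)" and m: "m \<in> J"
  obtains b where "x = vec2 0 b"
proof -
  have "x \<in> coord_space 2" using x by (simp add: isotypic_part_def sysG_sigma_def)
  then obtain a b where ab: "x = vec2 a b" by (rule coord_space_2_cases)
  have "vec2 1 0 \<in> sub (sysG_sigma m s) m" by (auto simp: sub_sysG_sigma)
  then have "a = 0"
    using isotypic_part_orth[OF x m] ab by (fastforce simp: sysG_sigma_def std_ip_2)
  then show ?thesis using ab that by blast
qed

lemma vec2_s_1_mem: "vec2 (complex_of_real s) 1 \<in> sub (sysG_sigma m s) (m + 1)"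
  unfolding sub_sysG_sigma by (rule image_eqI[of _ _ 1]) auto

text \<open>
  The two lines at positions \<open>m\<close> and \<open>m + 1\<close> in the plane of this summand are distinct, and
  they are not orthogonal since \<^term>\<open>s\<close> is nonzero. Hence no nonzero vector is, for each of the two
  lines, contained in it or orthogonal to it.
\<close>

lemma isotypic_part_sysG_sigma_zero:
  assumes x: "x \<in> isotypic_part I J K l (sysG_sigma m s)" and s: "s > 0"
    and m: "m \<in> I \<or> m \<in> J" "m + 1 \<in> I \<or> m + 1 \<in> J"
  shows "x = 0"
  using m(1)
proof
  assume "m \<in> J"
  then obtain b where b: "x = vec2 0 b" using x isotypic_part_sysG_sigma_orth by blast
  from m(2) show ?thesis
  proof
    assume "m + 1 \<in> I"
    then have "x \<in> sub (sysG_sigma m s) (m + 1)" using isotypic_part_sub_mem[OF x] by blast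
    then show ?thesis using s unfolding sub_sysG_sigma by (auto simp: b vec2_eq_iff vec2_0)
  next
    assume "m + 1 \<in> J"
    then have "ip (sysG_sigma m s) x (vec2 s 1) = 0"
      using isotypic_part_orth[OF x] vec2_s_1_mem by blast
    then show ?thesis by (simp add: sysG_sigma_def std_ip_2 b vec2_0)
  qed
next
  assume "m \<in> I"
  then have "x \<in> sub (sysG_sigma m s) m" using isotypic_part_sub_mem[OF x] by blast
  then obtain a where a: "x = vec2 a 0" unfolding sub_sysG_sigma by auto
  from m(2) show ?thesis
  proof
    assume "m + 1 \<in> I"
    then have "x \<in> sub (sysG_sigma m s) (m + 1)" using isotypic_part_sub_mem[OF x] by blast
    then show ?thesis using s unfolding sub_sysG_sigma by (auto simp: a vec2_eq_iff vec2_0)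
  next
    assume "m + 1 \<in> J"
    then have "ip (sysG_sigma m s) x (vec2 s 1) = 0"
      using isotypic_part_orth[OF x] vec2_s_1_mem by blast
    then show ?thesis using s by (simp add: sysG_sigma_def std_ip_2 a vec2_0)
  qed
qed

text \<open>
  The squared cosine of the angle between the lines spanned by \<open>(1, 0)\<close> and \<open>(s, 1)\<close>. It is the
  eigenvalue on the first line of the projection onto the second line followed by the
  projection back.
\<close>

definition angle_eigenvalue :: "real \<Rightarrow> complex" where
  "angle_eigenvalue s = of_real (s\<^sup>2 / (s\<^sup>2 + 1))"

lemma angle_eigenvalue_neq: "angle_eigenvalue s \<noteq> 1" "s > 0 \<Longrightarrow> angle_eigenvalue s \<noteq> 0"
proof -
  have "s\<^sup>2 + 1 > 0" by (simp add: add_nonneg_pos)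
  then have "s\<^sup>2 / (s\<^sup>2 + 1) \<noteq> 1" by simp
  then show "angle_eigenvalue s \<noteq> 1" unfolding angle_eigenvalue_def by (metis of_real_eq_1_iff)
  show "s > 0 \<Longrightarrow> angle_eigenvalue s \<noteq> 0"
    using \<open>s\<^sup>2 + 1 > 0\<close> unfolding angle_eigenvalue_def of_real_eq_0_iff by simp
qed

lemma angle_eigenvalue_inj:
  assumes "s > 0" "u > 0" "angle_eigenvalue s = angle_eigenvalue u"
  shows "s = u"
proof -
  have pos: "s\<^sup>2 + 1 > 0" "u\<^sup>2 + 1 > 0" by (simp_all add: add_nonneg_pos)
  have "s\<^sup>2 / (s\<^sup>2 + 1) = u\<^sup>2 / (u\<^sup>2 + 1)"
    using assms(3) unfolding angle_eigenvalue_def of_real_eq_iff .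
  then have "s\<^sup>2 * (u\<^sup>2 + 1) = u\<^sup>2 * (s\<^sup>2 + 1)"
    using pos by (simp add: frac_eq_eq)
  then have "s\<^sup>2 = u\<^sup>2" by (simp add: algebra_simps)
  then show ?thesis using assms by (simp add: power2_eq_iff_nonneg)
qed

text \<open>
  With \<open>x = (a, 0)\<close> and \<open>y = b (s, 1)\<close>, the orthogonality conditions read
  \<open>a s = b (s\<^sup>2 + 1)\<close> and \<open>b s = l a\<close>. Eliminating \<open>b\<close> leaves \<open>a = 0\<close> or
  \<open>l = s\<^sup>2 / (s\<^sup>2 + 1)\<close>.
\<close>

lemma isotypic_part_sysG_sigma:
  assumes s: "s > 0"
  shows "isotypic_part {m} {} {m} l (sysG_sigma m s) =
    (if l = angle_eigenvalue s then cspan {vec2 1 0} else {0})"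
proof -
  have pos: "s\<^sup>2 + 1 > 0" by (simp add: add_nonneg_pos)
  have eig: "(\<exists>b::complex. a * s = b * (s\<^sup>2 + 1) \<and> b * s = l * a) \<longleftrightarrow> a = 0 \<or> l = angle_eigenvalue s" for a :: complex
  proof -
    have c: "complex_of_real (s\<^sup>2 + 1) \<noteq> 0" using pos by (metis less_irrefl of_real_eq_0_iff)
    have "(\<exists>b::complex. a * s = b * (s\<^sup>2 + 1) \<and> b * s = l * a) \<longleftrightarrow>
        a * s / complex_of_real (s\<^sup>2 + 1) * s = l * a"
    proof -
      have "a * s = b * complex_of_real (s\<^sup>2 + 1) \<longleftrightarrow> b = a * s / complex_of_real (s\<^sup>2 + 1)" for b
        using c by (metis eq_divide_eq)
      then show ?thesis by simp
    qed
    also have "\<dots> \<longleftrightarrow> a = 0 \<or> l = angle_eigenvalue s"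
    proof -
      have "a * s / complex_of_real (s\<^sup>2 + 1) * s = a * angle_eigenvalue s"
        by (simp add: angle_eigenvalue_def power2_eq_square)
      then show ?thesis by (auto simp: mult.commute[of l])
    qed
    finally show ?thesis .
  qed
  have "x \<in> isotypic_part {m} {} {m} l (sysG_sigma m s) \<longleftrightarrow>
      (\<exists>a::complex. x = vec2 a 0 \<and> (\<exists>b::complex. a * s = b * (s\<^sup>2 + 1) \<and> b * s = l * a))" for x
  proof -
    have "x \<in> isotypic_part {m} {} {m} l (sysG_sigma m s) \<longleftrightarrow>
        (\<exists>a::complex. x = vec2 a 0 \<and> (\<exists>b::complex.
          (\<forall>c::complex. std_ip 2 (x - vec2 (b * s) b) (vec2 (c * s) c) = 0) \<and>
          (\<forall>c. std_ip 2 (vec2 (b * s) b - l *\<^sub>C x) (vec2 c 0) = 0)))"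
      unfolding isotypic_part_def
      by (auto simp: sub_sysG_sigma sub_sysG_sigma[simplified] vec2_in_coord_space)
        (auto simp: sysG_sigma_def vec2_in_coord_space)
    also have "\<dots> \<longleftrightarrow> (\<exists>a::complex. x = vec2 a 0 \<and> (\<exists>b::complex. a * s = b * (s\<^sup>2 + 1) \<and> b * s = l * a))"
    proof (intro ex_cong1 conj_cong refl)
      fix a b :: complex assume x: "x = vec2 a 0"
      have "(\<forall>c::complex. std_ip 2 (x - vec2 (b * s) b) (vec2 (c * s) c) = 0) \<longleftrightarrow> (a - b * s) * s - b = 0"
        (is "?L \<longleftrightarrow> ?R")
      proof
        show ?R if ?L using that[rule_format, of 1] by (simp add: std_ip_2 x vec2_diff)
        show ?L if ?R
        proof
          fix c :: complex
          have "std_ip 2 (x - vec2 (b * s) b) (vec2 (c * s) c) = ((a - b * s) * s - b) * cnj c"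
            by (simp add: std_ip_2 x vec2_diff algebra_simps)
          then show "std_ip 2 (x - vec2 (b * s) b) (vec2 (c * s) c) = 0" using that by simp
        qed
      qed
      moreover have "(a - b * s) * s - b = 0 \<longleftrightarrow> a * s = b * (s\<^sup>2 + 1)"
        by (auto simp: algebra_simps power2_eq_square)
      moreover have "(\<forall>c. std_ip 2 (vec2 (b * s) b - l *\<^sub>C x) (vec2 c 0) = 0) \<longleftrightarrow> b * s = l * a"
        by (auto simp: std_ip_2 x scaleC_vec2 vec2_diff dest: spec[of _ 1])
      ultimately show "(\<forall>c::complex. std_ip 2 (x - vec2 (b * s) b) (vec2 (c * s) c) = 0) \<longleftrightarrow>
          a * s = b * (s\<^sup>2 + 1)"
        and "(\<forall>c. std_ip 2 (vec2 (b * s) b - l *\<^sub>C x) (vec2 c 0) = 0) \<longleftrightarrow> b * s = l * a"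
        by simp_all
    qed
    finally show ?thesis .
  qed
  then have "x \<in> isotypic_part {m} {} {m} l (sysG_sigma m s) \<longleftrightarrow>
      (\<exists>a::complex. x = vec2 a 0 \<and> (a = 0 \<or> l = angle_eigenvalue s))" for x
    unfolding eig .
  then show ?thesis
    by (auto simp: cspan_vec2 vec2_0)
qed


section \<open>Uniqueness of the decomposition\<close>

lemma summand_cases:
  assumes "S \<in> semichain_summands r t p"
  obtains (F0) "S = sysF0"
  | (F) m where "S = sysF m" "1 \<le> m" "m \<le> t"
  | (G_sigma) m s where "S = sysG_sigma m s" "1 \<le> m" "m < t" "s > 0"
  | (G) m where "S = sysG m" "1 \<le> m" "m < t"
  using assms by (auto simp: semichain_summands_def chain_summands_def)

lemma summand_shape:
  assumes "S \<in> semichain_summands r t p"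
  obtains n where "carr S = coord_space n" "ip S = std_ip n" "\<And>i. 0 \<in> sub S i"
  using assms
proof (cases rule: summand_cases)
  case (G_sigma m s)
  then have "0 \<in> sub S i" for i
    using complex_vector.span_zero by (auto simp: sysG_sigma_def coord_space_def)
  then show ?thesis using that[of 2] G_sigma by (simp add: sysG_sigma_def)
qed (use that[of 1] in \<open>auto simp: summand_defs coord_space_def\<close>)

lemma isotypic_part_eq_zeroI:
  assumes S: "S \<in> semichain_summands r t p"
    and x: "\<And>x. x \<in> isotypic_part I J K l S \<Longrightarrow> x = 0"
  shows "isotypic_part I J K l S = {0}"
  using S
proof (cases rule: summand_shape)
  case (1 n)
  then show ?thesis using isotypic_part_zero_mem[of S n I J K l] x by blast
qed

lemma isotypic_part_sub_zero:
  "x \<in> isotypic_part I J K l S \<Longrightarrow> i \<in> I \<Longrightarrow> sub S i = {0} \<Longrightarrow> x = 0"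
  by (auto simp: isotypic_part_def)

lemma isotypic_part_orth_carr:
  assumes S: "S \<in> semichain_summands r t p"
    and x: "x \<in> isotypic_part I J K l S" "j \<in> J" "sub S j = carr S"
  shows "x = 0"
  using S
proof (cases rule: summand_shape)
  case (1 n)
  moreover have "x \<in> carr S" using x by (simp add: isotypic_part_def)
  ultimately show ?thesis using isotypic_part_orthogonal_member[OF 1(1,2)] x by blast
qed

lemma vec2_1_0_nonzero: "vec2 1 0 \<noteq> 0"
  using vec2_eq_iff[of 1 0 0 0] by (simp add: vec2_0)

text \<open>
  Every other summand has a full subspace at some position, or two lines spanning it.
\<close>

lemma separates_sysF0:
  assumes S: "S \<in> semichain_summands r t p"
  shows "separates {} {1..t} {} 0 sysF0 S"
proof (cases "S = sysF0")
  case True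
  have "isotypic_part {} {1..t} {} 0 sysF0 = cspan {vec2 1 0}"
    unfolding coord_space_1[symmetric] by (auto simp: isotypic_part_def sysF0_def std_ip_def)
  then show ?thesis using True vec2_1_0_nonzero by (auto simp: separates_def)
next
  case False
  have "x = 0" if x: "x \<in> isotypic_part {} {1..t} {} 0 S" for x
    using S
  proof (cases rule: summand_cases)
    case F0 then show ?thesis using False by simp
  next
    case (F m)
    then show ?thesis using isotypic_part_orth_carr[OF S x, of m] by (simp add: sysF_def)
  next
    case (G m)
    then show ?thesis using isotypic_part_orth_carr[OF S x, of m] by (simp add: sysG_def)
  next
    case (G_sigma m s)
    then show ?thesis using isotypic_part_sysG_sigma_zero[OF x[unfolded G_sigma(1)] G_sigma(4)] by auto
  qed
  then show ?thesis using isotypic_part_eq_zeroI[OF S] False by (simp add: separates_def)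
qed

lemma separates_sysF:
  assumes S: "S \<in> semichain_summands r t p" and k: "1 \<le> k" "k \<le> t"
  shows "separates {k..t} {1..<k} {} 0 (sysF k) S"
proof (cases "S = sysF k")
  case True
  have "isotypic_part {k..t} {1..<k} {} 0 (sysF k) = cspan {vec2 1 0}"
    unfolding coord_space_1[symmetric] by (auto simp: isotypic_part_def sysF_def std_ip_def)
  then show ?thesis using True vec2_1_0_nonzero by (auto simp: separates_def)
next
  case False
  have "x = 0" if x: "x \<in> isotypic_part {k..t} {1..<k} {} 0 S" for x
    using S
  proof (cases rule: summand_cases)
    case F0
    then show ?thesis using isotypic_part_sub_zero[OF x, of k] k by (simp add: sysF0_def)
  next
    case (F m)
    then have "m \<noteq> k" using False by auto
    then have "m < k \<or> k < m" by auto
    then show ?thesis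
      using isotypic_part_orth_carr[OF S x, of m] isotypic_part_sub_zero[OF x, of k] F k
      by (auto simp: sysF_def)
  next
    case (G m)
    show ?thesis
    proof (cases "k \<le> m + 1")
      case True
      then show ?thesis using isotypic_part_sub_zero[OF x, of "m + 1"] G by (simp add: sysG_def)
    next
      case False
      then show ?thesis using isotypic_part_orth_carr[OF S x, of m] G by (simp add: sysG_def)
    qed
  next
    case (G_sigma m s)
    then show ?thesis 
      by (intro isotypic_part_sysG_sigma_zero[OF x[unfolded G_sigma(1)] G_sigma(4)])
        (use G_sigma k in \<open>simp; linarith\<close>)+
  qed
  then show ?thesis using isotypic_part_eq_zeroI[OF S] False by (simp add: separates_def)
qed

text \<open>
  Orthogonality to the subspace at \<open>k + 1\<close> rules out the summands whose subspace is full
  there, and membership at \<open>k\<close> rules out those whose subspace is zero there. The plane summands with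
  lines at these two positions drop out because their lines are not orthogonal.
\<close>

lemma separates_sysG:
  assumes S: "S \<in> semichain_summands r t p" and k: "1 \<le> k" "k < t"
  shows "separates {k} (insert (k + 1) {1..<k}) {} 0 (sysG k) S"
proof (cases "S = sysG k")
  case True
  have "isotypic_part {k} (insert (k + 1) {1..<k}) {} 0 (sysG k) = cspan {vec2 1 0}"
    unfolding coord_space_1[symmetric] by (auto simp: isotypic_part_def sysG_def std_ip_def)
  then show ?thesis using True vec2_1_0_nonzero by (auto simp: separates_def)
next
  case False
  have "x = 0" if x: "x \<in> isotypic_part {k} (insert (k + 1) {1..<k}) {} 0 S" for x
    using S
  proof (cases rule: summand_cases)
    case F0
    then show ?thesis using isotypic_part_sub_zero[OF x, of k] by (simp add: sysF0_def)
  next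
    case (F m)
    show ?thesis
    proof (cases "k < m")
      case True
      then show ?thesis using isotypic_part_sub_zero[OF x, of k] F by (simp add: sysF_def)
    next
      case False
      then show ?thesis using isotypic_part_orth_carr[OF S x, of "k + 1"] F by (simp add: sysF_def)
    qed
  next
    case (G m)
    then have "m \<noteq> k" using False by auto
    then have "m < k \<or> k < m" by auto
    then show ?thesis
      using isotypic_part_orth_carr[OF S x, of m] isotypic_part_sub_zero[OF x, of k] G
      by (auto simp: sysG_def)
  next
    case (G_sigma m s)
    then show ?thesis
    proof (cases "k < m")
      case True
      then show ?thesis
        using isotypic_part_sub_zero[OF x, of k] G_sigma by (simp add: sysG_sigma_def)
    next
      case False
      then show ?thesis
        by (intro isotypic_part_sysG_sigma_zero[OF x[unfolded G_sigma(1)] G_sigma(4)])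
          (use G_sigma k in \<open>simp; linarith\<close>)+
    qed
  qed
  then show ?thesis using isotypic_part_eq_zeroI[OF S] False by (simp add: separates_def)
qed

text \<open>
  Outside of the summands with lines at positions \<open>k\<close> and \<open>k + 1\<close>, the operator
  \<open>P\<^sub>k P\<^sub>k\<^sub>+\<^sub>1\<close> on the \<open>k\<close>-th subspace is the identity or zero, and the squared cosine of an angle
  strictly between zero and a right angle is neither 1 nor 0. Among the summands with lines
  at these positions, the angle determines the parameter.
\<close>

lemma separates_sysG_sigma:
  assumes S: "S \<in> semichain_summands r t p" and k: "1 \<le> k" "k < t" "s > 0"
  shows "separates {k} {} {k} (angle_eigenvalue s) (sysG_sigma k s) S"
proof (cases "S = sysG_sigma k s")
  case True
  then show ?thesis using isotypic_part_sysG_sigma[OF k(3)] vec2_1_0_nonzero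
    by (auto simp: separates_def)
next
  case False
  let ?l = "angle_eigenvalue s"
  have nested: "x = 0" if "x \<in> isotypic_part {k} {} {k} ?l S" "sub S k \<subseteq> sub S (k + 1)" for x
  proof -
    have c: "csubspace (sub S (k + 1))" "sub S (k + 1) \<subseteq> carr S"
      using configuration_summand[OF S] k by (auto simp: configuration_def)
    from S show ?thesis
    proof (cases rule: summand_shape)
      case (1 n)
      then show ?thesis
        using isotypic_part_nested[OF 1(1,2) that(1) _ _ that(2) c(1)] c(2) angle_eigenvalue_neq(1)
        by simp
    qed
  qed
  have "x = 0" if x: "x \<in> isotypic_part {k} {} {k} ?l S" for x
    using S
  proof (cases rule: summand_cases)
    case F0
    then show ?thesis using isotypic_part_sub_zero[OF x, of k] by (simp add: sysF0_def)
  next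
    case (F m)
    have "0 \<in> coord_space 1" by (simp add: coord_space_def)
    then show ?thesis using nested[OF x] F by (auto simp: sysF_def)
  next
    case (G m)
    have z: "0 \<in> coord_space 1" by (simp add: coord_space_def)
    show ?thesis
    proof (cases "m = k")
      case True
      have xc: "x \<in> coord_space 1" using x G by (simp add: isotypic_part_def sysG_def)
      have "\<forall>u\<in>coord_space 1. std_ip 1 (- (?l *\<^sub>C x)) u = 0"
        using x True unfolding isotypic_part_def by (auto simp: G sysG_def)
      then have "?l * x 0 * cnj (x 0) = 0"
        using xc by (auto simp: std_ip_def scaleC_fun_def scaleC_complex_def)
      then have "std_ip 1 x x = 0" using angle_eigenvalue_neq(2)[OF k(3)] by (simp add: std_ip_def)
      then show ?thesis using xc std_ip_self_eq_0 by blast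
    next
      case False
      then show ?thesis using nested[OF x] isotypic_part_sub_zero[OF x, of k] G z
        by (cases "k < m") (auto simp: sysG_def)
    qed
  next
    case (G_sigma m u)
    consider "k < m" | "k = m" | "m < k" by linarith
    then show ?thesis
    proof cases
      case 1
      then show ?thesis
        using isotypic_part_sub_zero[OF x, of k] G_sigma by (simp add: sysG_sigma_def)
    next
      case 2
      then have "?l \<noteq> angle_eigenvalue u"
        using angle_eigenvalue_inj[OF k(3) G_sigma(4)] False G_sigma by auto
      then show ?thesis
        using isotypic_part_sysG_sigma[OF G_sigma(4), of m ?l] x G_sigma 2 by simp
    next
      case 3
      have "cspan {vec2 (complex_of_real u) 1} \<subseteq> coord_space 2"
        by (auto simp: cspan_vec2 vec2_in_coord_space)
      then show ?thesis using nested[OF x] 3 G_sigma by (simp add: sysG_sigma_def)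
    qed
  qed
  then show ?thesis using isotypic_part_eq_zeroI[OF S] False by (simp add: separates_def)
qed

lemma summand_separated:
  assumes "T \<in> semichain_summands r t p"
  obtains I J K l where "I \<subseteq> {1..t}" "J \<subseteq> {1..t}" "K \<subseteq> {1..<t}"
    "\<forall>S\<in>semichain_summands r t p. separates I J K l T S"
  using assms
proof (cases rule: summand_cases)
  case F0
  then show ?thesis using that[of "{}" "{1..t}" "{}" 0] separates_sysF0 by auto
next
  case (F m)
  then show ?thesis using that[of "{m..t}" "{1..<m}" "{}" 0] separates_sysF by force
next
  case (G_sigma m s)
  then show ?thesis
    using that[of "{m}" "{}" "{m}" "angle_eigenvalue s"] separates_sysG_sigma by force
next
  case (G m)
  then show ?thesis
    using that[of "{m}" "insert (m + 1) {1..<m}" "{}" 0] separates_sysG by fastforce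
qed

text \<open>
  The multiplicity of a summand is the dimension of an isotypic part of \<^term>\<open>U\<close> itself, which does
  not refer to any decomposition.
\<close>

lemma decomposition_unique:
  assumes U: "configuration t U"
    and Ss: "set Ss \<subseteq> semichain_summands r t p" "isometric t U (orth_sum Ss)"
    and Ts: "set Ts \<subseteq> semichain_summands r t p" "isometric t U (orth_sum Ts)"
  shows "mset Ts = mset Ss"
proof (rule multiset_eqI)
  fix T
  show "count (mset Ts) T = count (mset Ss) T"
  proof (cases "T \<in> semichain_summands r t p")
    case False
    then have "T \<notin> set Ts" "T \<notin> set Ss" using Ss(1) Ts(1) by auto
    then show ?thesis by (metis count_mset_0_iff)
  next
    case True
    then obtain I J K l where IJK: "I \<subseteq> {1..t}" "J \<subseteq> {1..t}" "K \<subseteq> {1..<t}"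
      and sep: "\<forall>S\<in>semichain_summands r t p. separates I J K l T S"
      by (rule summand_separated)
    have count: "has_dim (isotypic_part I J K l U) (count (mset Rs) T)"
      if Rs: "set Rs \<subseteq> semichain_summands r t p" "isometric t U (orth_sum Rs)" for Rs
    proof -
      have conf: "\<forall>S\<in>set Rs. configuration t S" using Rs(1) configuration_summand by blast
      have dim: "has_dim (isotypic_part I J K l (orth_sum Rs)) (count (mset Rs) T)"
        using has_dim_isotypic_part_orth_sum[OF IJK] conf sep Rs(1) unfolding separates_def by blast
      obtain f where f: "isometry_via t (orth_sum Rs) U f"
        using isometric_sym[OF Rs(2) U] by (auto simp: isometric_iff)
      have "isotypic_part I J K l U = f ` isotypic_part I J K l (orth_sum Rs)"
        by (rule isotypic_part_isometry[OF configuration_orth_sum[OF conf] f IJK])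
      moreover have "isotypic_part I J K l (orth_sum Rs) \<subseteq> carr (orth_sum Rs)"
        by (auto simp: isotypic_part_def)
      ultimately show ?thesis
        using has_dim_image[OF dim] f linear_on_subset inj_on_subset
        unfolding isometry_via_def bij_betw_def by metis
    qed
    show ?thesis using has_dim_unique[OF count[OF Ts] count[OF Ss]] .
  qed
qed


section \<open>Eigenvectors and orthogonal projections\<close>

lemma linear_on_zero: "linear_on A f \<Longrightarrow> csubspace A \<Longrightarrow> f 0 = 0"
  using linear_on_diff[of A f 0 0] by (simp add: complex_vector.subspace_0)

text \<open>
  The vectors \<open>v, T v, T\<^sup>2 v, \<dots>\<close> are linearly dependent, so some nonzero polynomial in \<open>T\<close>
  annihilates \<open>v\<close>. Choose one of least degree and split off a linear factor \<open>X - z\<close> by the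
  fundamental theorem of algebra; the cofactor does not annihilate \<open>v\<close> and maps it to an
  eigenvector for \<open>z\<close>.
\<close>

lemma exists_eigenvector:
  fixes T :: "'a::complex_vector \<Rightarrow> 'a"
  assumes A: "csubspace A" "finite B" "A \<subseteq> cspan B" and v: "v \<in> A" "v \<noteq> 0"
    and T: "linear_on A T" "T ` A \<subseteq> A"
  obtains x l where "x \<in> A" "x \<noteq> 0" "T x = l *\<^sub>C x"
proof -
  \<comment> \<open>\<open>ev q\<close> is \<open>q(T) v\<close>, computed by the Horner scheme.\<close>
  define ev where "ev q = foldr (\<lambda>a w. a *\<^sub>C v + T w) (coeffs q) 0" for q
  have T0: "T 0 = 0" by (rule linear_on_zero[OF T(1) A(1)])
  have ev_0: "ev 0 = 0" by (simp add: ev_def)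
  have ev_pCons: "ev (pCons a q) = a *\<^sub>C v + T (ev q)" for a q
    by (simp add: ev_def coeffs_pCons_eq_cCons cCons_def T0 complex_vector.scale_zero_left)
  have TA: "T x \<in> A" if "x \<in> A" for x using T(2) that by auto
  have mem: "ev q \<in> A" for q
  proof (induction q)
    case 0 show ?case using A(1) by (simp add: ev_0 complex_vector.subspace_0)
  next
    case (pCons a q)
    then show ?case unfolding ev_pCons
      by (intro complex_vector.subspace_add[OF A(1)] complex_vector.subspace_scale[OF A(1)] v TA)
  qed
  have Tadd: "T (x + y) = T x + T y" if "x \<in> A" "y \<in> A" for x y
    using T(1) that by (auto simp: linear_on_def)
  have Tscale: "T (c *\<^sub>C x) = c *\<^sub>C T x" if "x \<in> A" for c x
    using T(1) that by (auto simp: linear_on_def)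
  have ev_add: "ev (q + q') = ev q + ev q'" for q q'
    by (induction q q' rule: poly_induct2)
      (simp_all add: ev_0 ev_pCons Tadd mem scaleC_add_left)
  have ev_smult: "ev (smult c q) = c *\<^sub>C ev q" for c q
    by (induction q)
      (simp_all add: ev_0 ev_pCons Tscale mem scaleC_add_right scaleC_scaleC complex_vector.scale_zero_right)
  have ev_diff: "ev (q - q') = ev q - ev q'" for q q'
    using ev_add[of "q - q'" q'] by simp
  have ev_monom: "ev (monom c i) = c *\<^sub>C (T ^^ i) v" for c i
  proof (induction i)
    case 0 show ?case by (simp add: monom_0 ev_pCons ev_0 T0)
  next
    case (Suc i)
    have "(T ^^ i) v \<in> A" by (induction i) (auto simp: v TA)
    then show ?case using Suc by (simp add: monom_Suc ev_pCons Tscale complex_vector.scale_zero_left)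
  qed
  have ev_sum: "ev (sum g M) = (\<Sum>i\<in>M. ev (g i))" if "finite M" for g and M :: "nat set"
    using that by (induction M) (simp_all add: ev_0 ev_add)
  obtain q where "q \<noteq> 0" "ev q = 0"
  proof -
    define w where "w i = (T ^^ i) v" for i :: nat
    have w: "ev (monom 1 i) = w i" for i by (simp add: ev_monom w_def scaleC_one)
    show ?thesis
    proof (cases "inj_on w {..card B}")
      case False
      then obtain i j where "w i = w j" "i \<noteq> j" by (auto simp: inj_on_def)
      then have "ev (monom 1 i - monom 1 j) = 0" "monom 1 i - monom 1 j \<noteq> (0 :: complex poly)"
        by (auto simp: ev_diff w monom_eq_iff')
      then show ?thesis using that by blast
    next
      case True
      then have c: "card (w ` {..card B}) = Suc (card B)" by (simp add: card_image)
      have "w ` {..card B} \<subseteq> cspan B" using mem w A(3) by (metis image_subsetI subsetD)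
      then have "complex_vector.dependent (w ` {..card B})"
        using complex_vector.independent_span_bound[OF A(2)] c by fastforce
      then obtain u i where u: "i \<le> card B" "u (w i) \<noteq> 0" "(\<Sum>x\<in>w ` {..card B}. u x *\<^sub>C x) = 0"
        using complex_vector.dependent_finite[of "w ` {..card B}"] by auto
      define q where "q = (\<Sum>i\<le>card B. monom (u (w i)) i)"
      have "ev q = (\<Sum>i\<le>card B. u (w i) *\<^sub>C w i)"
        by (simp add: q_def ev_sum ev_monom w_def)
      also have "\<dots> = 0" using u(3) by (simp add: sum.reindex[OF True])
      finally have "ev q = 0" .
      moreover have "coeff q i = u (w i)" using u(1) by (simp add: q_def coeff_sum)
      ultimately show ?thesis using that[of q] u(2) by (metis coeff_0)
    qed
  qed
  then obtain q where q: "q \<noteq> 0" "ev q = 0" and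
    least: "\<And>q'. q' \<noteq> 0 \<Longrightarrow> ev q' = 0 \<Longrightarrow> degree q \<le> degree q'"
    using ex_has_least_nat[of "\<lambda>q. q \<noteq> 0 \<and> ev q = 0" q degree] by blast
  have "degree q \<noteq> 0"
  proof
    assume "degree q = 0"
    then obtain a where a: "q = [:a:]" by (rule degree_eq_zeroE)
    then have "a *\<^sub>C v = 0" using q(2) by (simp add: ev_pCons ev_0 T0)
    then show False using a q(1) v(2) complex_vector.scale_eq_0_iff by auto
  qed
  then obtain z where "poly q z = 0"
    using fundamental_theorem_of_algebra[of q] constant_degree[of q] by auto
  then obtain q' where q': "q = [:- z, 1:] * q'" by (auto simp: poly_eq_0_iff_dvd elim: dvdE)
  have q'0: "q' \<noteq> 0" using q' q(1) by auto
  then have "degree q = Suc (degree q')" unfolding q' by (subst degree_mult_eq) auto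
  then have "ev q' \<noteq> 0" using least[OF q'0] by auto
  have "q = pCons 0 q' - smult z q'" by (simp add: q')
  then have "T (ev q') = z *\<^sub>C ev q'"
    using q(2) by (simp add: ev_diff ev_smult ev_pCons complex_vector.scale_zero_left)
  then show ?thesis using that mem \<open>ev q' \<noteq> 0\<close> by blast
qed

context unitary_space
begin

lemmas carr_0 = complex_vector.subspace_0[OF subspace_carr]
  and carr_add = complex_vector.subspace_add[OF subspace_carr]
  and carr_scale = complex_vector.subspace_scale[OF subspace_carr]
  and carr_diff = complex_vector.subspace_diff[OF subspace_carr]

lemma carr_sum: "(\<And>j. j \<in> J \<Longrightarrow> f j \<in> carr V) \<Longrightarrow> (\<Sum>j\<in>J. s j *\<^sub>C f j) \<in> carr V"
  by (intro complex_vector.subspace_sum[OF subspace_carr] carr_scale)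

lemma ip_zero_left: "y \<in> carr V \<Longrightarrow> ip V 0 y = 0"
  using ip_scale[OF carr_0, of y 0] by (simp add: complex_vector.scale_zero_left)

lemma ip_diff: "x \<in> carr V \<Longrightarrow> y \<in> carr V \<Longrightarrow> z \<in> carr V \<Longrightarrow> ip V (x - y) z = ip V x z - ip V y z"
  using ip_add[of "x - y" y z] carr_diff[of x y] by simp

lemma ip_zero_right: "x \<in> carr V \<Longrightarrow> ip V x 0 = 0"
  using ip_cnj[OF carr_0, of x] ip_zero_left by simp

lemma ip_add_right:
  "x \<in> carr V \<Longrightarrow> y \<in> carr V \<Longrightarrow> z \<in> carr V \<Longrightarrow> ip V x (y + z) = ip V x y + ip V x z"
  using ip_cnj[of "y + z" x] ip_cnj[of y x] ip_cnj[of z x] ip_add[of y z x] carr_add[of y z] by simp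

lemma ip_scale_right:
  "x \<in> carr V \<Longrightarrow> y \<in> carr V \<Longrightarrow> ip V x (c *\<^sub>C y) = cnj c * ip V x y"
  using ip_cnj[of "c *\<^sub>C y" x] ip_cnj[of y x] ip_scale[of y x c] carr_scale[of y c] by simp

lemma ip_sum:
  assumes "finite J" "\<And>j. j \<in> J \<Longrightarrow> f j \<in> carr V" "y \<in> carr V"
  shows "ip V (\<Sum>j\<in>J. s j *\<^sub>C f j) y = (\<Sum>j\<in>J. s j * ip V (f j) y)"
  using assms
proof (induction J)
  case (insert j J)
  then show ?case using carr_sum[of J f s] by (simp add: ip_add ip_scale carr_scale)
qed (simp add: ip_zero_left)

lemma ip_sym_eq_0: "x \<in> carr V \<Longrightarrow> y \<in> carr V \<Longrightarrow> ip V x y = 0 \<Longrightarrow> ip V y x = 0"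
  using ip_cnj[of x y] by simp

lemma ip_self_eq_0: "x \<in> carr V \<Longrightarrow> ip V x x = 0 \<Longrightarrow> x = 0"
  using ip_pos[of x] by force

lemma ip_self_real: "x \<in> carr V \<Longrightarrow> ip V x x = of_real (Re (ip V x x))"
  using ip_cnj[of x x] by (simp add: complex_eq_iff)

lemma normalize:
  assumes "x \<in> carr V" "x \<noteq> 0"
  obtains c :: real where "ip V (of_real c *\<^sub>C x) (of_real c *\<^sub>C x) = 1"
proof -
  define c where "c = 1 / sqrt (Re (ip V x x))"
  have pos: "Re (ip V x x) > 0" using ip_pos assms by blast
  then have cc: "c * c * Re (ip V x x) = 1" by (simp add: c_def)
  have "ip V (of_real c *\<^sub>C x) (of_real c *\<^sub>C x) = of_real c * of_real c * of_real (Re (ip V x x))"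
    using assms ip_self_real[of x] by (simp add: ip_scale ip_scale_right carr_scale)
  also have "\<dots> = of_real (c * c * Re (ip V x x))" by simp
  finally show ?thesis using that cc by simp
qed

lemma finite_spanning_set:
  assumes "csubspace A" "A \<subseteq> carr V"
  obtains B where "finite B" "complex_vector.independent B" "B \<subseteq> A" "cspan B = A"
proof -
  obtain B0 where B0: "finite B0" "cspan B0 = carr V" using finite_dim by blast
  obtain B where B: "B \<subseteq> A" "complex_vector.independent B" "A \<subseteq> cspan B"
    by (rule complex_vector.maximal_independent_subset)
  have "finite B" using complex_vector.independent_span_bound[OF B0(1) B(2)] B0(2) B(1) assms(2) by auto
  moreover have "cspan B = A" using complex_vector.span_minimal[OF B(1) assms(1)] B(3) by auto
  ultimately show ?thesis using that B by blast
qed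

definition is_projection :: "'a set \<Rightarrow> 'a \<Rightarrow> 'a \<Rightarrow> bool" where
  "is_projection A x a \<longleftrightarrow> a \<in> A \<and> (\<forall>b\<in>A. ip V (x - a) b = 0)"

text \<open>
  The Gram-Schmidt step: the new spanning vector is replaced by its component orthogonal to
  the span of the others.
\<close>

lemma exists_projection_span:
  assumes "finite S" "S \<subseteq> carr V" "x \<in> carr V"
  shows "\<exists>a. is_projection (cspan S) x a"
  using assms
proof (induction S arbitrary: x)
  case empty
  then show ?case by (auto simp: is_projection_def ip_zero_right complex_vector.span_empty)
next
  case (insert s S)
  have sp: "cspan S \<subseteq> carr V"
    using insert.prems subspace_carr by (intro complex_vector.span_minimal) auto
  have spi: "cspan (insert s S) \<subseteq> carr V"
    using insert.prems subspace_carr by (intro complex_vector.span_minimal) auto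
  obtain q where q: "is_projection (cspan S) s q" using insert by blast
  obtain a where a: "is_projection (cspan S) x a" using insert by blast
  define s' where "s' = s - q"
  \<comment> \<open>If \<open>s' = 0\<close>, then \<open>c = 0\<close> by the convention on division, and the formula below still holds.\<close>
  define c where "c = ip V (x - a) s' / ip V s' s'"
  have carr: "s \<in> carr V" "x \<in> carr V" "q \<in> carr V" "a \<in> carr V" "s' \<in> carr V"
    using insert.prems q a sp carr_diff unfolding is_projection_def s'_def by auto
  have "q \<in> cspan (insert s S)" "a \<in> cspan (insert s S)" "s \<in> cspan (insert s S)"
    using q a complex_vector.span_mono[of S "insert s S"] complex_vector.span_base[of s "insert s S"]
    by (auto simp: is_projection_def)
  then have mem: "a + c *\<^sub>C s' \<in> cspan (insert s S)"
    unfolding s'_def by (intro complex_vector.span_add complex_vector.span_scale complex_vector.span_diff)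
  have eq: "x - (a + c *\<^sub>C s') = (x - a) - c *\<^sub>C s'" by simp
  have xa: "x - a \<in> carr V" "c *\<^sub>C s' \<in> carr V" using carr carr_diff carr_scale by auto
  have s0: "ip V (x - (a + c *\<^sub>C s')) s' = 0"
    using carr xa ip_self_eq_0[of s'] ip_zero_right[of "x - a"] unfolding eq
    by (cases "s' = 0") (auto simp: c_def ip_diff ip_scale)
  have "ip V (x - (a + c *\<^sub>C s')) b = 0" if bS: "b \<in> cspan (insert s S)" for b
  proof -
    obtain k where k: "b - k *\<^sub>C s \<in> cspan S" using bS unfolding complex_vector.span_insert by blast
    define w where "w = b - k *\<^sub>C s + k *\<^sub>C q"
    have w: "w \<in> cspan S" unfolding w_def
      using k q by (intro complex_vector.span_add complex_vector.span_scale) (auto simp: is_projection_def)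
    have b: "b = w + k *\<^sub>C s'"
      by (simp add: w_def s'_def complex_vector.scale_right_diff_distrib)
    have wc: "w \<in> carr V" using w sp by auto
    have "ip V (x - a) w = 0" "ip V s' w = 0" using a q w by (auto simp: is_projection_def s'_def)
    then have "ip V (x - (a + c *\<^sub>C s')) w = 0"
      unfolding eq using xa wc carr by (simp add: ip_diff ip_scale)
    moreover have xx: "x - (a + c *\<^sub>C s') \<in> carr V" unfolding eq using xa carr_diff by blast
    ultimately show ?thesis unfolding b
      using s0 ip_add_right[OF xx wc carr_scale[OF carr(5)], of k] ip_scale_right[OF xx carr(5), of k]
      by simp
  qed
  then show ?case using mem unfolding is_projection_def by blast
qed

lemma exists_projection:
  assumes "csubspace A" "A \<subseteq> carr V" "x \<in> carr V"
  obtains a where "is_projection A x a"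
proof -
  obtain B where "finite B" "complex_vector.independent B" "B \<subseteq> A" "cspan B = A"
    by (rule finite_spanning_set[OF assms(1,2)])
  then have "\<exists>a. is_projection (cspan B) x a" using exists_projection_span[of B x] assms by auto
  then show ?thesis using that \<open>cspan B = A\<close> by auto
qed

lemma projection_unique:
  assumes A: "csubspace A" "A \<subseteq> carr V" "x \<in> carr V"
    and a: "is_projection A x a" "is_projection A x a'"
  shows "a = a'"
proof -
  have d: "a - a' \<in> A" using a A complex_vector.subspace_diff by (auto simp: is_projection_def)
  have c: "a \<in> carr V" "a' \<in> carr V" using a A by (auto simp: is_projection_def)
  have "a - a' = (x - a') - (x - a)" by simp
  then have "ip V (a - a') (a - a') = ip V (x - a') (a - a') - ip V (x - a) (a - a')"
    using d A c by (metis carr_diff ip_diff subsetD)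
  also have "\<dots> = 0" using a d by (auto simp: is_projection_def)
  finally show ?thesis using ip_self_eq_0[of "a - a'"] c carr_diff by auto
qed

definition projection :: "'a set \<Rightarrow> 'a \<Rightarrow> 'a" where
  "projection A x = (SOME a. is_projection A x a)"

lemma is_projection_projection:
  assumes "csubspace A" "A \<subseteq> carr V" "x \<in> carr V"
  shows "is_projection A x (projection A x)"
  unfolding projection_def using exists_projection[OF assms] by (metis someI)

lemma linear_on_projection:
  assumes A: "csubspace A" "A \<subseteq> carr V"
  shows "linear_on (carr V) (projection A)"
  unfolding linear_on_def
proof (intro conjI ballI allI)
  fix x y assume xy: "x \<in> carr V" "y \<in> carr V"
  let ?x = "projection A x" and ?y = "projection A y"
  have p: "is_projection A x ?x" "is_projection A y ?y"
    using is_projection_projection[OF A] xy by auto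
  then have c: "?x \<in> carr V" "?y \<in> carr V" using A by (auto simp: is_projection_def)
  have "ip V (x + y - (?x + ?y)) b = 0" if b: "b \<in> A" for b
  proof -
    have "ip V ((x - ?x) + (y - ?y)) b = 0"
      using p b xy c A carr_diff by (subst ip_add) (auto simp: is_projection_def)
    then show ?thesis unfolding add_diff_add .
  qed
  then have "is_projection A (x + y) (?x + ?y)"
    using p A complex_vector.subspace_add by (auto simp: is_projection_def)
  then show "projection A (x + y) = ?x + ?y"
    using projection_unique[OF A _ is_projection_projection[OF A]] carr_add xy by blast
next
  fix c x assume x: "x \<in> carr V"
  let ?x = "projection A x"
  have p: "is_projection A x ?x" using is_projection_projection[OF A] x by auto
  then have xc: "?x \<in> carr V" using A by (auto simp: is_projection_def)
  have "ip V (c *\<^sub>C x - c *\<^sub>C ?x) b = 0" if b: "b \<in> A" for b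
  proof -
    have "ip V (c *\<^sub>C (x - ?x)) b = 0"
      using p b x xc A carr_diff by (subst ip_scale) (auto simp: is_projection_def)
    then show ?thesis by (simp add: complex_vector.scale_right_diff_distrib)
  qed
  then have "is_projection A (c *\<^sub>C x) (c *\<^sub>C ?x)"
    using p A complex_vector.subspace_scale by (auto simp: is_projection_def)
  then show "projection A (c *\<^sub>C x) = c *\<^sub>C ?x"
    using projection_unique[OF A _ is_projection_projection[OF A]] carr_scale x by blast
qed

text \<open>
  The vector \<^term>\<open>x\<close> is an eigenvector of the projection onto \<^term>\<open>B\<close> followed by the projection
  back onto \<^term>\<open>A\<close>, so \<open>x\<close> and its projection \<open>y\<close> realize one of the principal angles between the
  two subspaces.
\<close>

lemma exists_principal_vector:
  assumes A: "csubspace A" "A \<subseteq> carr V" and B: "csubspace B" "B \<subseteq> carr V"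
    and v: "v \<in> A" "v \<noteq> 0"
  obtains x y l where "x \<in> A" "ip V x x = 1" "is_projection B x y" "is_projection A y (l *\<^sub>C x)"
proof -
  define T where "T x = projection A (projection B x)" for x
  have PB: "projection B x \<in> B" if "x \<in> carr V" for x
    using is_projection_projection[OF B that] by (simp add: is_projection_def)
  have PA: "projection A x \<in> A" if "x \<in> carr V" for x
    using is_projection_projection[OF A that] by (simp add: is_projection_def)
  have TA: "T ` A \<subseteq> A" using PA PB A B by (auto simp: T_def)
  have T: "linear_on (carr V) T"
    unfolding T_def linear_on_def
    using linear_on_projection[OF A] linear_on_projection[OF B] PB B
    by (auto simp: linear_on_def subset_iff)
  then have "linear_on A T" using linear_on_subset A by blast
  obtain S where "finite S" "cspan S = A" using finite_spanning_set[OF A] by metis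
  then obtain x l where x: "x \<in> A" "x \<noteq> 0" "T x = l *\<^sub>C x"
    using exists_eigenvector[OF A(1) _ _ v \<open>linear_on A T\<close> TA, of S] by blast
  obtain c :: real where c: "ip V (of_real c *\<^sub>C x) (of_real c *\<^sub>C x) = 1"
    using normalize[of x] x A by blast
  let ?x = "of_real c *\<^sub>C x"
  have xA: "?x \<in> A" using x A complex_vector.subspace_scale by blast
  then have xV: "?x \<in> carr V" using A by auto
  have "T ?x = l *\<^sub>C ?x"
    using T x A by (auto simp: linear_on_def scaleC_scaleC mult.commute)
  then have "is_projection A (projection B ?x) (l *\<^sub>C ?x)"
    using is_projection_projection[OF A, of "projection B ?x"] PB[OF xV] B by (auto simp: T_def)
  then show ?thesis using that[OF xA c is_projection_projection[OF B xV]] by blast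
qed

end


section \<open>Splitting off a summand\<close>

definition frame_comb :: "nat \<Rightarrow> (nat \<Rightarrow> 'a::complex_vector) \<Rightarrow> (nat \<Rightarrow> complex) \<Rightarrow> 'a" where
  "frame_comb n e s = (\<Sum>j<n. s j *\<^sub>C e j)"

definition frame_coords :: "'a subspace_system \<Rightarrow> nat \<Rightarrow> (nat \<Rightarrow> 'a) \<Rightarrow> 'a \<Rightarrow> nat \<Rightarrow> complex" where
  "frame_coords U n e u = (\<lambda>j. if j < n then ip U u (e j) else 0)"

text \<open>
  An orthonormal family \<^term>\<open>e\<close> spans a subspace \<open>W\<close>. The coordinate map, which is the orthogonal
  projection onto \<open>W\<close>, and its adjoint carry the subspaces of \<^term>\<open>U\<close> and \<^term>\<open>S\<close> into each other
  exactly if each subspace of \<open>U\<close> is the sum of its intersections with \<open>W\<close> and with the orthogonal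
  complement of \<open>W\<close>, and the former intersections form a copy of \<open>S\<close>.
\<close>

definition reducing_frame ::
  "nat \<Rightarrow> 'a::complex_vector subspace_system \<Rightarrow> (nat \<Rightarrow> complex) subspace_system \<Rightarrow> nat \<Rightarrow>
     (nat \<Rightarrow> 'a) \<Rightarrow> bool" where
  "reducing_frame t U S n e \<longleftrightarrow>
     carr S = coord_space n \<and> ip S = std_ip n \<and>
     (\<forall>j<n. e j \<in> carr U) \<and> (\<forall>i<n. \<forall>j<n. ip U (e i) (e j) = (if i = j then 1 else 0)) \<and>
     (\<forall>i\<in>{1..t}. sub S i \<subseteq> coord_space n \<and> frame_comb n e ` sub S i \<subseteq> sub U i \<and>
        frame_coords U n e ` sub U i \<subseteq> sub S i)"

definition frame_complement ::
  "'a::complex_vector subspace_system \<Rightarrow> nat \<Rightarrow> (nat \<Rightarrow> 'a) \<Rightarrow> 'a subspace_system" where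
  "frame_complement U n e = \<lparr>carr = {u \<in> carr U. \<forall>j<n. ip U u (e j) = 0}, ip = ip U,
     sub = (\<lambda>i. {u \<in> sub U i. \<forall>j<n. ip U u (e j) = 0})\<rparr>"

lemma P_system_frame_complement:
  assumes P: "P_system r t p U" and e: "\<forall>j<n. e j \<in> carr U"
  shows "P_system r t p (frame_complement U n e)"
proof -
  interpret unitary_space U using P by (simp add: P_system_def)
  let ?C = "frame_complement U n e"
  have sp: "csubspace {u \<in> A. \<forall>j<n. ip U u (e j) = 0}" if "csubspace A" "A \<subseteq> carr U" for A
    using that e
    by (intro complex_vector.subspaceI)
      (auto simp: ip_zero_left ip_add ip_scale subset_iff complex_vector.subspace_0
        complex_vector.subspace_add complex_vector.subspace_scale)
  have C: "csubspace (carr ?C)" "carr ?C \<subseteq> carr U"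
    using sp[OF subspace_carr] by (auto simp: frame_complement_def)
  obtain B where "finite B" "complex_vector.independent B" "B \<subseteq> carr ?C" "cspan B = carr ?C"
    by (rule finite_spanning_set[OF C])
  then have "\<exists>B. finite B \<and> cspan B = carr ?C" by blast
  moreover have ipC: "ip ?C = ip U" by (simp add: frame_complement_def)
  ultimately have "unitary_space ?C"
    using C(1)
  proof (intro unitary_space.intro)
    show "ip ?C (x + y) z = ip ?C x z + ip ?C y z"
      if "x \<in> carr ?C" "y \<in> carr ?C" "z \<in> carr ?C" for x y z
      unfolding ipC using that C(2) by (intro ip_add) auto
    show "ip ?C (c *\<^sub>C x) y = c * ip ?C x y" if "x \<in> carr ?C" "y \<in> carr ?C" for x y c
      unfolding ipC using that C(2) by (intro ip_scale) auto
    show "ip ?C y x = cnj (ip ?C x y)" if "x \<in> carr ?C" "y \<in> carr ?C" for x y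
      unfolding ipC using that C(2) by (intro ip_cnj) auto
    show "Re (ip ?C x x) > 0" if "x \<in> carr ?C" "x \<noteq> 0" for x
      unfolding ipC using that C(2) by (intro ip_pos) auto
  qed
  moreover have "csubspace (sub ?C i)" "sub ?C i \<subseteq> carr ?C" if "i \<in> {1..t}" for i
    using P sp[of "sub U i"] that by (auto simp: P_system_def frame_complement_def)
  moreover have "sub ?C i \<subseteq> sub ?C j" if "sub U i \<subseteq> sub U j" for i j
    using that by (auto simp: frame_complement_def)
  ultimately show ?thesis
    using P unfolding P_system_def by blast
qed

text \<open>
  Each vector is sent to its coordinates with respect to \<^term>\<open>e\<close> together with its component
  orthogonal to \<^term>\<open>e\<close>; the scalar product splits by the theorem of Pythagoras.
\<close>

lemma isometric_split_off:
  assumes P: "P_system r t p U" and F: "reducing_frame t U S n e"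
  shows "isometric t U (orth_sum2 S (frame_complement U n e))"
proof -
  interpret unitary_space U using P by (simp add: P_system_def)
  let ?C = "frame_complement U n e"
  let ?x = "frame_coords U n e" and ?w = "frame_comb n e"
  have S: "carr S = coord_space n" "ip S = std_ip n"
    and e: "\<And>j. j < n \<Longrightarrow> e j \<in> carr U"
    and on: "\<And>i j. i < n \<Longrightarrow> j < n \<Longrightarrow> ip U (e i) (e j) = (if i = j then 1 else 0)"
    and sub: "\<And>i. i \<in> {1..t} \<Longrightarrow> sub S i \<subseteq> coord_space n"
      "\<And>i. i \<in> {1..t} \<Longrightarrow> ?w ` sub S i \<subseteq> sub U i" "\<And>i. i \<in> {1..t} \<Longrightarrow> ?x ` sub U i \<subseteq> sub S i"
    using F by (auto simp: reducing_frame_def)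
  have U: "\<And>i. i \<in> {1..t} \<Longrightarrow> csubspace (sub U i)" "\<And>i. i \<in> {1..t} \<Longrightarrow> sub U i \<subseteq> carr U"
    using P by (auto simp: P_system_def)
  have wc: "?w s \<in> carr U" for s unfolding frame_comb_def by (rule carr_sum) (simp add: e)
  have ip_w: "ip U (?w s) u = (\<Sum>j<n. s j * ip U (e j) u)" if "u \<in> carr U" for s u
    unfolding frame_comb_def by (rule ip_sum) (simp_all add: e that)
  have xc: "?x u \<in> coord_space n" for u by (simp add: frame_coords_def coord_space_def)
  have xw: "?x (?w s) = s" if "s \<in> coord_space n" for s
    using that by (auto simp: fun_eq_iff frame_coords_def ip_w e on coord_space_def if_distrib cong: if_cong)
  have x_add: "?x (u + v) = ?x u + ?x v" if "u \<in> carr U" "v \<in> carr U" for u v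
    using that by (auto simp: frame_coords_def fun_eq_iff ip_add e)
  have x_scale: "?x (c *\<^sub>C u) = c *\<^sub>C ?x u" if "u \<in> carr U" for c u
    using that by (auto simp: frame_coords_def fun_eq_iff ip_scale e scaleC_fun_def scaleC_complex_def)
  have w_add: "?w (s + s') = ?w s + ?w s'" for s s'
    by (simp add: frame_comb_def scaleC_add_left sum.distrib)
  have w_scale: "?w (c *\<^sub>C s) = c *\<^sub>C ?w s" for c s
    by (simp add: frame_comb_def scaleC_fun_def scaleC_complex_def scaleC_scaleC
        complex_vector.scale_sum_right)
  have x0: "?x v = 0 \<longleftrightarrow> (\<forall>j<n. ip U v (e j) = 0)" for v
    by (auto simp: frame_coords_def fun_eq_iff)
  have w0: "?w 0 = 0" by (simp add: frame_comb_def complex_vector.scale_zero_left)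
  define rest where "rest u = u - ?w (?x u)" for u
  have rc: "rest u \<in> carr U" if "u \<in> carr U" for u unfolding rest_def using carr_diff[OF that wc] .
  have xr: "?x (rest u) = 0" if u: "u \<in> carr U" for u
    using x_add[OF rc[OF u] wc, of "?x u"] xw[OF xc] by (simp add: rest_def)
  have carrC: "v \<in> carr ?C \<longleftrightarrow> v \<in> carr U \<and> ?x v = 0" for v
    by (auto simp: frame_complement_def x0)
  have subC: "v \<in> sub ?C i \<longleftrightarrow> v \<in> sub U i \<and> ?x v = 0" for v i
    by (auto simp: frame_complement_def x0)
  have x_wv: "?x (?w s + v) = s" if "s \<in> coord_space n" "v \<in> carr U" "?x v = 0" for s v
    using x_add[OF wc that(2)] xw[OF that(1)] that(3) by simp
  let ?\<phi> = "\<lambda>u. (?x u, rest u)"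
  have "isometry_via t U (orth_sum2 S ?C) ?\<phi>"
    unfolding isometry_via_def
  proof (intro conjI ballI)
    show "bij_betw ?\<phi> (carr U) (carr (orth_sum2 S ?C))"
    proof (rule bij_betw_byWitness[where f' = "\<lambda>(s, v). ?w s + v"])
      show "\<forall>u\<in>carr U. (case ?\<phi> u of (s, v) \<Rightarrow> ?w s + v) = u" by (simp add: rest_def)
      show "\<forall>z\<in>carr (orth_sum2 S ?C). ?\<phi> (case z of (s, v) \<Rightarrow> ?w s + v) = z"
        by (auto simp: orth_sum2_def S carrC x_wv rest_def)
      show "?\<phi> ` carr U \<subseteq> carr (orth_sum2 S ?C)"
        by (auto simp: orth_sum2_def S xc carrC rc xr)
      show "(\<lambda>(s, v). ?w s + v) ` carr (orth_sum2 S ?C) \<subseteq> carr U"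
        by (auto simp: orth_sum2_def carrC wc carr_add)
    qed
    show "linear_on (carr U) ?\<phi>"
      by (auto simp: linear_on_def x_add x_scale w_add w_scale rest_def scaleC_prod_def
          complex_vector.scale_right_diff_distrib)
    fix u v assume uv: "u \<in> carr U" "v \<in> carr U"
    have "ip U u v = ip U (?w (?x u) + rest u) v" by (simp add: rest_def)
    also have "\<dots> = ip U (?w (?x u)) v + ip U (rest u) v"
      by (rule ip_add[OF wc rc[OF uv(1)] uv(2)])
    also have "ip U (?w (?x u)) v = std_ip n (?x u) (?x v)"
      unfolding ip_w[OF uv(2)] std_ip_def
      by (rule sum.cong) (simp_all add: frame_coords_def flip: ip_cnj[OF uv(2) e])
    also have "ip U (rest u) v = ip U (rest u) (rest v)"
    proof -
      have "ip U (?w (?x v)) (rest u) = 0"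
        unfolding ip_w[OF rc[OF uv(1)]]
        using xr[OF uv(1)] x0 ip_sym_eq_0[OF rc[OF uv(1)] e] by simp
      then have "ip U (rest u) (?w (?x v)) = 0"
        using ip_sym_eq_0[OF wc rc[OF uv(1)]] by blast
      moreover have "v = ?w (?x v) + rest v" by (simp add: rest_def)
      ultimately show ?thesis
        using ip_add_right[OF rc[OF uv(1)] wc rc[OF uv(2)], of "?x v"] by simp
    qed
    finally show "ip (orth_sum2 S ?C) (?\<phi> u) (?\<phi> v) = ip U u v"
      by (simp add: orth_sum2_def S frame_complement_def)
  next
    fix i assume i: "i \<in> {1..t}"
    show "?\<phi> ` sub U i = sub (orth_sum2 S ?C) i"
    proof (intro equalityI subsetI)
      fix z assume "z \<in> ?\<phi> ` sub U i"
      then obtain u where u: "u \<in> sub U i" "z = ?\<phi> u" by auto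
      then have "?x u \<in> sub S i" "?w (?x u) \<in> sub U i" using sub(2,3)[OF i] by auto
      then have "rest u \<in> sub U i"
        unfolding rest_def using complex_vector.subspace_diff[OF U(1)[OF i] u(1)] by blast
      then show "z \<in> sub (orth_sum2 S ?C) i"
        using u \<open>?x u \<in> sub S i\<close> U(2)[OF i] xr by (auto simp: orth_sum2_def subC)
    next
      fix z assume "z \<in> sub (orth_sum2 S ?C) i"
      then obtain s v where z: "z = (s, v)" "s \<in> sub S i" "v \<in> sub U i" "?x v = 0"
        by (auto simp: orth_sum2_def subC)
      then have mem: "?w s + v \<in> sub U i"
        using sub(2)[OF i] complex_vector.subspace_add[OF U(1)[OF i]] by auto
      have "?x (?w s + v) = s" using z sub(1)[OF i] U(2)[OF i] by (intro x_wv) auto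
      then have "?\<phi> (?w s + v) = z" using z by (simp add: rest_def)
      then show "z \<in> ?\<phi> ` sub U i" using mem by blast
    qed
  qed
  then show ?thesis by (auto simp: isometric_iff)
qed


section \<open>The order of a semichain\<close>

text \<open>
  Along a compatible enumeration, a semichain is a sequence in which only neighbours can be
  incomparable and two incomparable pairs never overlap. Chains and semichains are both
  treated through this property.
\<close>

definition semichain_gaps :: "'p rel \<Rightarrow> nat \<Rightarrow> (nat \<Rightarrow> 'p) \<Rightarrow> bool" where
  "semichain_gaps r t p \<longleftrightarrow>
     (\<forall>i j. 1 \<le> i \<and> i + 2 \<le> j \<and> j \<le> t \<longrightarrow> strictly r (p i) (p j)) \<and>
     (\<forall>k. 1 \<le> k \<and> k + 2 \<le> t \<and> \<not> strictly r (p k) (p (k + 1)) \<longrightarrow> strictly r (p (k + 1)) (p (k + 2)))"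

lemma strictly_trans:
  assumes "partial_order_on P r" "strictly r a b" "strictly r b c"
  shows "strictly r a c"
  using assms unfolding strictly_def partial_order_on_def preorder_on_def
  by (metis antisymD transD)

lemma poset_chain_strictly:
  assumes P: "enumerated_poset P r t p" and c: "poset_chain r t p"
    and i: "1 \<le> i" "i < j" "j \<le> t"
  shows "strictly r (p i) (p j)"
proof -
  have po: "partial_order_on P r" using P by (simp add: enumerated_poset_def)
  have "i + Suc d \<le> t \<Longrightarrow> strictly r (p i) (p (i + Suc d))" for d
  proof (induction d)
    case 0
    then show ?case using c i by (simp add: poset_chain_def)
  next
    case (Suc d)
    have "strictly r (p (i + Suc d)) (p (i + Suc d + 1))"
      using c i Suc.prems unfolding poset_chain_def by simp
    then show ?case using strictly_trans[OF po] Suc by simp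
  qed
  from this[of "j - i - 1"] show ?thesis using i by simp
qed

lemma semichain_gaps_poset_chain:
  assumes "enumerated_poset P r t p" "poset_chain r t p"
  shows "semichain_gaps r t p"
  using poset_chain_strictly[OF assms] by (auto simp: semichain_gaps_def)

text \<open>
  In a chain the side condition of the plane summands and of the summands \<^term>\<open>sysG k\<close> never holds.
\<close>

lemma semichain_summands_poset_chain:
  assumes "poset_chain r t p" shows "semichain_summands r t p = chain_summands t"
  using assms by (auto simp: semichain_summands_def poset_chain_def)

text \<open>
  Let \<open>l i\<close> be the index of the block that contains \<open>p i\<close>. It increases weakly along the
  enumeration, an increase of \<open>l\<close> means strict order, and among three successive elements
  it increases since a block has at most two elements.
\<close>

lemma semichain_gaps_poset_semichain:
  assumes P: "enumerated_poset P r t p" and sc: "poset_semichain P r"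
  shows "semichain_gaps r t p"
proof -
  have po: "partial_order_on P r" and bij: "bij_betw p {1..t} P"
    and enum: "\<And>i j. i \<in> {1..t} \<Longrightarrow> j \<in> {1..t} \<Longrightarrow> strictly r (p i) (p j) \<Longrightarrow> i < j"
    using P by (auto simp: enumerated_poset_def)
  obtain s :: nat and Q where Q: "P = (\<Union>i\<in>{1..s}. Q i)"
    "\<And>i. i \<in> {1..s} \<Longrightarrow> (\<exists>a. Q i = {a}) \<or> (\<exists>a b. Q i = {a, b} \<and> (a, b) \<notin> r \<and> (b, a) \<notin> r)"
    "\<And>i a b. 1 \<le> i \<Longrightarrow> i < s \<Longrightarrow> a \<in> Q i \<Longrightarrow> b \<in> Q (i + 1) \<Longrightarrow> strictly r a b"
  proof -
    obtain s :: nat and Q where *: "P = (\<Union>i\<in>{1..s}. Q i) \<and> disjoint_family_on Q {1..s} \<and>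
        (\<forall>i\<in>{1..s}. (\<exists>a. Q i = {a}) \<or>
           (\<exists>a b. Q i = {a, b} \<and> (a, b) \<notin> r \<and> (b, a) \<notin> r)) \<and>
        (\<forall>i. 1 \<le> i \<and> i < s \<longrightarrow> (\<forall>a\<in>Q i. \<forall>b\<in>Q (i + 1). strictly r a b))"
      using sc unfolding poset_semichain_def by (elim exE) (rule that)
    show thesis by (rule that[of Q s]) (use * in simp_all)
  qed
  have "\<forall>i\<in>{1..t}. \<exists>l\<in>{1..s}. p i \<in> Q l"
    using bij Q(1) by (auto simp: bij_betw_def)
  then obtain l where l: "\<And>i. i \<in> {1..t} \<Longrightarrow> l i \<in> {1..s} \<and> p i \<in> Q (l i)" by metis
  have up: "m + Suc d \<le> s \<Longrightarrow> 1 \<le> m \<Longrightarrow> a \<in> Q m \<Longrightarrow> b \<in> Q (m + Suc d) \<Longrightarrow> strictly r a b" for m d a b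
  proof (induction d arbitrary: b)
    case 0
    then show ?case using Q(3)[of m a b] by simp
  next
    case (Suc d)
    obtain c where c: "c \<in> Q (m + Suc d)" using Q(2)[of "m + Suc d"] Suc.prems by auto
    then have "strictly r a c" using Suc by simp
    moreover have "strictly r c b" using Q(3)[of "m + Suc d" c b] c Suc.prems by simp
    ultimately show ?case using strictly_trans[OF po] by blast
  qed
  have less: "strictly r (p i) (p j)" if "i \<in> {1..t}" "j \<in> {1..t}" "l i < l j" for i j
    using up[of "l i" "l j - l i - 1" "p i" "p j"] l[OF that(1)] l[OF that(2)] that(3) by simp
  have mono: "l i \<le> l j" if "i \<in> {1..t}" "j \<in> {1..t}" "i < j" for i j
    using less[of j i] enum[of j i] that by force
  have three: "l i < l (i + 1) \<or> l (i + 1) < l (i + 2)" if "1 \<le> i" "i + 2 \<le> t" for i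
  proof (rule ccontr)
    assume neg: "\<not> ?thesis"
    have it: "i \<in> {1..t}" "i + 1 \<in> {1..t}" "i + 2 \<in> {1..t}" using that by auto
    have "l (i + 1) = l i" "l (i + 2) = l i"
      using neg mono[OF it(1,2)] mono[OF it(2,3)] by auto
    then have mem: "p i \<in> Q (l i)" "p (i + 1) \<in> Q (l i)" "p (i + 2) \<in> Q (l i)"
      using l[OF it(1)] l[OF it(2)] l[OF it(3)] by auto
    have "p i \<noteq> p (i + 1)" "p i \<noteq> p (i + 2)" "p (i + 1) \<noteq> p (i + 2)"
      using inj_on_eq_iff[OF bij_betw_imp_inj_on[OF bij]] it by simp_all
    moreover obtain a b where "Q (l i) \<subseteq> {a, b}" using Q(2)[of "l i"] l[OF it(1)] by blast
    ultimately show False using mem by blast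
  qed
  show ?thesis
    unfolding semichain_gaps_def
  proof (intro conjI allI impI)
    fix i j assume ij: "1 \<le> i \<and> i + 2 \<le> j \<and> j \<le> t"
    have "l i \<le> l (i + 1)" "l (i + 1) \<le> l (i + 2)" using mono ij by auto
    moreover have "l (i + 2) \<le> l j" using mono[of "i + 2" j] ij by (cases "i + 2 = j") auto
    ultimately have "l i < l j" using three[of i] ij by auto
    then show "strictly r (p i) (p j)" using less ij by auto
  next
    fix k assume k: "1 \<le> k \<and> k + 2 \<le> t \<and> \<not> strictly r (p k) (p (k + 1))"
    then have "\<not> l k < l (k + 1)" using less[of k "k + 1"] by auto
    then have "l (k + 1) < l (k + 2)" using three[of k] k by auto
    then show "strictly r (p (k + 1)) (p (k + 2))" using less k by auto
  qed
qed


section \<open>Existence of the decomposition\<close>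

lemma frame_comb_2: "frame_comb 2 e s = s 0 *\<^sub>C e 0 + s 1 *\<^sub>C e 1"
  by (simp add: frame_comb_def numeral_2_eq_2)

lemma reducing_frame_line:
  assumes P: "P_system r t p U" and x: "x \<in> carr U" "ip U x x = 1"
    and S: "carr S = coord_space 1" "ip S = std_ip 1"
      "\<And>i. i \<in> {1..t} \<Longrightarrow>
        (sub S i = coord_space 1 \<and> x \<in> sub U i) \<or> (sub S i = {0} \<and> (\<forall>u\<in>sub U i. ip U u x = 0))"
  shows "reducing_frame t U S 1 (\<lambda>_. x)"
proof -
  have "sub S i \<subseteq> coord_space 1 \<and> frame_comb 1 (\<lambda>_. x) ` sub S i \<subseteq> sub U i \<and>
        frame_coords U 1 (\<lambda>_. x) ` sub U i \<subseteq> sub S i" if i: "i \<in> {1..t}" for i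
  proof -
    have U: "csubspace (sub U i)" using P i by (auto simp: P_system_def)
    from S(3)[OF i] show ?thesis
    proof
      assume "sub S i = coord_space 1 \<and> x \<in> sub U i"
      then show ?thesis
        using complex_vector.subspace_scale[OF U]
        by (auto simp: frame_comb_def frame_coords_def coord_space_def)
    next
      assume "sub S i = {0} \<and> (\<forall>u\<in>sub U i. ip U u x = 0)"
      then show ?thesis
        using complex_vector.subspace_0[OF U]
        by (auto simp: frame_comb_def frame_coords_def coord_space_def fun_eq_iff
            complex_vector.scale_zero_left)
    qed
  qed
  then show ?thesis using x S(1,2) by (simp add: reducing_frame_def)
qed

text \<open>
  If all subspaces are zero, any unit vector spans a copy of \<^term>\<open>sysF0\<close>. Otherwise let \<open>A\<close> be the
  first nonzero subspace, at position \<open>k\<close>. All later subspaces contain \<open>A\<close>, except possibly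
  the next one, \<open>B\<close>. If \<open>k = t\<close> or the order puts \<open>A\<close> below \<open>B\<close>, any unit vector of \<open>A\<close> spans
  a copy of \<^term>\<open>sysF k\<close>. If \<open>A\<close> and \<open>B\<close> belong to incomparable elements, take a unit eigenvector \<open>x \<in> A\<close> of
  \<open>P\<^sub>A P\<^sub>B\<close> and \<open>y = P\<^sub>B x\<close>. The subspace spanned by \<open>x\<close> and \<open>y\<close> reduces the system: a vector of
  \<open>B\<close> has the same scalar product with \<open>x\<close> as with \<open>y\<close>, and a vector of \<open>A\<close> orthogonal to \<open>x\<close> is
  orthogonal to \<open>P\<^sub>A y\<close>, a multiple of \<open>x\<close>, hence to \<open>y\<close>. Depending on whether \<open>y\<close> is zero, a
  nonzero multiple of \<open>x\<close>, or neither, this is a copy of \<^term>\<open>sysG k\<close>, \<^term>\<open>sysF k\<close> or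
  \<^term>\<open>sysG_sigma k s\<close>.
\<close>

lemma exists_reducing_frame:
  assumes P: "P_system r t p U" and gaps: "semichain_gaps r t p" and nz: "carr U \<noteq> {0}"
  obtains S n e where "S \<in> semichain_summands r t p" "0 < n" "reducing_frame t U S n e"
proof -
  note frame_thesis = that
  interpret unitary_space U using P by (simp add: P_system_def)
  have sub: "csubspace (sub U i)" "sub U i \<subseteq> carr U" if "i \<in> {1..t}" for i
    using P that by (auto simp: P_system_def)
  have mono: "sub U i \<subseteq> sub U j" if "i \<in> {1..t}" "j \<in> {1..t}" "strictly r (p i) (p j)" for i j
    using P that by (auto simp: P_system_def)
  have line: thesis
    if "S \<in> semichain_summands r t p" "carr S = coord_space 1" "ip S = std_ip 1"
      "x \<in> carr U" "ip U x x = 1"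
      "\<And>i. i \<in> {1..t} \<Longrightarrow>
        (sub S i = coord_space 1 \<and> x \<in> sub U i) \<or> (sub S i = {0} \<and> (\<forall>u\<in>sub U i. ip U u x = 0))"
    for S x
    using frame_thesis[OF that(1) _ reducing_frame_line[OF P that(4,5,2,3,6)]] by simp
  show thesis
  proof (cases "\<exists>k\<in>{1..t}. sub U k \<noteq> {0}")
    case False
    obtain x where x: "x \<in> carr U" "x \<noteq> 0" using nz carr_0 by auto
    obtain c :: real where c: "ip U (of_real c *\<^sub>C x) (of_real c *\<^sub>C x) = 1"
      using normalize[OF x] by blast
    have xc: "of_real c *\<^sub>C x \<in> carr U" using carr_scale[OF x(1)] .
    show thesis
      by (rule line[OF _ _ _ xc c, of sysF0])
        (use False xc in \<open>auto simp: sysF0_def semichain_summands_def chain_summands_def ip_zero_left\<close>)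
  next
    case True
    then have "\<exists>k. k \<in> {1..t} \<and> sub U k \<noteq> {0}" by blast
    then obtain k where k: "k \<in> {1..t}" "sub U k \<noteq> {0}"
      and least': "\<And>i. i < k \<Longrightarrow> \<not> (i \<in> {1..t} \<and> sub U i \<noteq> {0})"
      unfolding exists_least_iff[of "\<lambda>k. k \<in> {1..t} \<and> sub U k \<noteq> {0}"] by (elim exE conjE) blast
    have least: "sub U i = {0}" if "i \<in> {1..t}" "i < k" for i
      using least'[OF that(2)] that(1) by simp
    let ?A = "sub U k"
    obtain v where v: "v \<in> ?A" "v \<noteq> 0"
      using k(2) complex_vector.subspace_0[OF sub(1)[OF k(1)]] by auto
    have orth0: "\<forall>u\<in>sub U i. ip U u x = 0" if "i \<in> {1..t}" "i < k" "x \<in> carr U" for i x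
      using least[OF that(1,2)] ip_zero_left[OF that(3)] by simp
    have later: "?A \<subseteq> sub U j" if "j \<in> {1..t}" "k + 2 \<le> j" for j
      using mono[OF k(1) that(1)] gaps k(1) that unfolding semichain_gaps_def by auto
    have useF: thesis
      if x: "x \<in> ?A" "ip U x x = 1" and next_mem: "k + 1 \<le> t \<Longrightarrow> x \<in> sub U (k + 1)" for x
    proof (rule line[of "sysF k" x])
      fix i assume i: "i \<in> {1..t}"
      have "i < k \<or> i = k \<or> i = k + 1 \<or> k + 2 \<le> i" by linarith
      then show "(sub (sysF k) i = coord_space 1 \<and> x \<in> sub U i) \<or>
          (sub (sysF k) i = {0} \<and> (\<forall>u\<in>sub U i. ip U u x = 0))"
        using x next_mem orth0[OF i] later[OF i] sub(2)[OF k(1)] i by (auto simp: sysF_def)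
    qed (use x k sub(2)[OF k(1)] in
        \<open>auto simp: sysF_def semichain_summands_def chain_summands_def\<close>)
    show thesis
    proof (cases "k < t \<and> \<not> strictly r (p k) (p (k + 1))")
      case False
      obtain c :: real where c: "ip U (of_real c *\<^sub>C v) (of_real c *\<^sub>C v) = 1"
        using normalize[of v] v sub(2)[OF k(1)] by blast
      have "of_real c *\<^sub>C v \<in> ?A" using complex_vector.subspace_scale[OF sub(1)[OF k(1)] v(1)] .
      then show thesis
        using useF[OF _ c] mono[OF k(1), of "k + 1"] False k(1) by auto
    next
      case True
      then have k1: "k + 1 \<in> {1..t}" using k(1) by auto
      let ?B = "sub U (k + 1)"
      have laterB: "?B \<subseteq> sub U j" if "j \<in> {1..t}" "k + 2 \<le> j" for j
      proof (cases "j = k + 2")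
        case eq: True
        then show ?thesis
          using mono[OF k1 that(1)] gaps k(1) that True unfolding semichain_gaps_def by auto
      next
        case False
        then show ?thesis
          using mono[OF k1 that(1)] gaps k1 that unfolding semichain_gaps_def by auto
      qed
      obtain x y l where x: "x \<in> ?A" "ip U x x = 1" and y: "is_projection ?B x y"
        and l: "is_projection ?A y (l *\<^sub>C x)"
        by (rule exists_principal_vector[OF sub[OF k(1)] sub[OF k1] v])
      have xc: "x \<in> carr U" using x sub(2)[OF k(1)] by auto
      have yB: "y \<in> ?B" using y by (simp add: is_projection_def)
      have yc: "y \<in> carr U" using yB sub(2)[OF k1] by auto
      have ub: "ip U u x = ip U u y" if u: "u \<in> ?B" for u
      proof -
        have uc: "u \<in> carr U" using u sub(2)[OF k1] by auto
        have "ip U (x - y) u = 0" using y u by (simp add: is_projection_def)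
        then have "ip U x u = ip U y u" using ip_diff[OF xc yc uc] by simp
        then show ?thesis using ip_cnj[OF xc uc] ip_cnj[OF yc uc] by simp
      qed
      show thesis
      proof (cases "y = 0")
        case y0: True
        show thesis
        proof (rule line[of "sysG k" x])
          fix i assume i: "i \<in> {1..t}"
          have "i < k \<or> i = k \<or> i = k + 1 \<or> k + 2 \<le> i" by linarith
          moreover have "\<forall>u\<in>?B. ip U u x = 0"
            using ub sub(2)[OF k1] by (auto simp: y0 ip_zero_right)
          ultimately show "(sub (sysG k) i = coord_space 1 \<and> x \<in> sub U i) \<or>
              (sub (sysG k) i = {0} \<and> (\<forall>u\<in>sub U i. ip U u x = 0))"
            using x orth0[OF i] later[OF i] xc by (auto simp: sysG_def)
        qed (use x k xc True in \<open>auto simp: sysG_def semichain_summands_def\<close>)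
      next
        case y0: False
        \<comment> \<open>\<open>b\<close> is the squared cosine of the angle between \<open>x\<close> and \<open>y\<close>, and \<open>z\<close> is the component of \<open>y\<close>
          orthogonal to \<open>x\<close>, of length \<open>q\<close> below.\<close>
        define b where "b = Re (ip U y y)"
        have b: "ip U y y = of_real b" "b > 0"
          using ip_self_real[OF yc] ip_pos[OF yc y0] by (auto simp: b_def)
        have yx: "ip U y x = of_real b" using ub[OF yB] b(1) by simp
        then have xy: "ip U x y = of_real b" using ip_cnj[OF yc xc] by simp
        define z where "z = y - of_real b *\<^sub>C x"
        have zc: "z \<in> carr U" unfolding z_def using carr_diff[OF yc carr_scale[OF xc]] .
        have zx: "ip U z x = 0"
          unfolding z_def using xc yc carr_scale[OF xc] by (simp add: ip_diff ip_scale yx x(2))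
        have "ip U z z = ip U z y"
          using zx ip_add_right[OF zc zc carr_scale[OF xc], of "of_real b"]
            ip_scale_right[OF zc xc, of "of_real b"] by (simp add: z_def)
        also have "\<dots> = of_real (b - b * b)"
          unfolding z_def using xc yc carr_scale[OF xc] by (simp add: ip_diff ip_scale b(1) xy)
        finally have zz: "ip U z z = of_real (b - b * b)" .
        show thesis
        proof (cases "z = 0")
          case z0: True
          have "y = of_real b *\<^sub>C x" using z0 by (simp add: z_def)
          then have "x = of_real (1 / b) *\<^sub>C y" using b(2) by (simp add: scaleC_scaleC scaleC_one)
          then have "x \<in> ?B" using complex_vector.subspace_scale[OF sub(1)[OF k1] yB] by metis
          then show thesis using useF[OF x] by blast
        next
          case z0: False
          define q where "q = sqrt (b - b * b)"
          have "b - b * b > 0" using ip_pos[OF zc z0] zz by simp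
          then have q: "q > 0" "q * q = b - b * b" by (auto simp: q_def)
          define e where "e i = (if i = 0 then x else of_real (1 / q) *\<^sub>C z)" for i :: nat
          \<comment> \<open>The line of \<open>y = b x + q e\<^sub>1\<close> is spanned by \<open>s x + e\<^sub>1\<close>.\<close>
          define s where "s = b / q"
          have s: "s > 0" using b q by (simp add: s_def)
          have e: "e 0 = x" "e 1 = of_real (1 / q) *\<^sub>C z" by (auto simp: e_def)
          have e1: "e 1 \<in> carr U" unfolding e using carr_scale[OF zc] .
          have e01: "ip U (e 1) x = 0" unfolding e using zx zc xc by (simp add: ip_scale)
          have e10: "ip U x (e 1) = 0" by (rule ip_sym_eq_0[OF e1 xc e01])
          have "ip U (e 1) (e 1) = of_real ((b - b * b) / (q * q))"
            unfolding e using zc by (simp add: ip_scale ip_scale_right carr_scale zz)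
          moreover have "(b - b * b) / (q * q) = 1" using q(1) by (simp flip: q(2))
          ultimately have e11: "ip U (e 1) (e 1) = 1" by (simp only: of_real_1)
          have y_e: "y = of_real b *\<^sub>C x + of_real q *\<^sub>C e 1"
            unfolding e using q(1) by (simp add: scaleC_scaleC scaleC_one z_def)
          have yu: "ip U y u = l * ip U x u" if u: "u \<in> ?A" for u
          proof -
            have uc: "u \<in> carr U" using u sub(2)[OF k(1)] by auto
            have "ip U (y - l *\<^sub>C x) u = 0" using l u by (simp add: is_projection_def)
            then show ?thesis
              using ip_diff[OF yc carr_scale[OF xc] uc] ip_scale[OF xc uc] by simp
          qed
          have lb: "l = of_real b" using yu[OF x(1)] yx x(2) by simp
          have eA: "ip U u (e 1) = 0" if u: "u \<in> ?A" for u
          proof -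
            have uc: "u \<in> carr U" using u sub(2)[OF k(1)] by auto
            have "ip U z u = 0"
              unfolding z_def using yu[OF u] lb ip_diff[OF yc carr_scale[OF xc] uc] ip_scale[OF xc uc]
              by simp
            then have "ip U (e 1) u = 0" unfolding e using zc uc by (simp add: ip_scale)
            then show ?thesis by (rule ip_sym_eq_0[OF e1 uc])
          qed
          have eB: "ip U u x = of_real s * ip U u (e 1)" if u: "u \<in> ?B" for u
          proof -
            have uc: "u \<in> carr U" using u sub(2)[OF k1] by auto
            let ?a = "ip U u x" and ?d = "ip U u (e 1)"
            have "?a = of_real b * ?a + of_real q * ?d"
              using ub[OF u] ip_add_right[OF uc carr_scale[OF xc] carr_scale[OF e1], of "of_real b" "of_real q"]
                ip_scale_right[OF uc xc, of "of_real b"] ip_scale_right[OF uc e1, of "of_real q"]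
              unfolding y_e[symmetric] by simp
            then have *: "of_real (1 - b) * ?a = of_real q * ?d" by (simp add: algebra_simps)
            have "of_real (q * q) * ?a = of_real b * (of_real (1 - b) * ?a)"
              by (simp add: q(2) algebra_simps)
            also have "\<dots> = of_real q * (of_real b * ?d)" unfolding * by simp
            finally have "of_real q * ?a = of_real b * ?d" using q(1) by simp
            then show ?thesis using q(1) by (simp add: s_def field_simps)
          qed
          have sB: "of_real s *\<^sub>C x + e 1 \<in> ?B"
          proof -
            have "of_real (1 / q) *\<^sub>C y = of_real s *\<^sub>C x + e 1"
              unfolding y_e using q(1) by (simp add: scaleC_add_right scaleC_scaleC scaleC_one s_def)
            then show ?thesis using complex_vector.subspace_scale[OF sub(1)[OF k1] yB] by metis
          qed
          have frame: "sub S i \<subseteq> coord_space 2 \<and> frame_comb 2 e ` sub S i \<subseteq> sub U i \<and>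
              frame_coords U 2 e ` sub U i \<subseteq> sub S i"
            if i: "i \<in> {1..t}" and S: "S = sysG_sigma k s" for i S
          proof -
            have coords: "frame_coords U 2 e u = vec2 (ip U u x) (ip U u (e 1))" for u
              by (auto simp: frame_coords_def vec2_def fun_eq_iff e(1) less_2_cases_iff)
            consider "i < k" | "i = k" | "i = k + 1" | "k + 2 \<le> i" by linarith
            then show ?thesis
            proof cases
              case 1
              then have "sub U i = {0}" "sub S i = {0}" using least[OF i] S by (auto simp: sysG_sigma_def)
              then show ?thesis
                using ip_zero_left[OF xc] ip_zero_left[OF e1]
                by (simp add: frame_comb_2 coords vec2_0 coord_space_def complex_vector.scale_zero_left)
            next
              case 2
              have A: "sub S k = range (\<lambda>c. vec2 c 0)" using sub_sysG_sigma(1)[of k s] S by simp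
              show ?thesis
                unfolding A 2 using eA complex_vector.subspace_scale[OF sub(1)[OF k(1)] x(1)]
                by (auto simp: frame_comb_2 coords e(1) complex_vector.scale_zero_left
                    vec2_in_coord_space)
            next
              case 3
              have B: "sub S (k + 1) = range (\<lambda>c. vec2 (c * of_real s) c)"
                using sub_sysG_sigma(2)[of k s] S by simp
              have "(c * of_real s) *\<^sub>C x + c *\<^sub>C e 1 \<in> ?B" for c
                using complex_vector.subspace_scale[OF sub(1)[OF k1] sB, of c]
                by (simp add: scaleC_add_right scaleC_scaleC)
              moreover have "frame_coords U 2 e u \<in> range (\<lambda>c. vec2 (c * of_real s) c)"
                if "u \<in> ?B" for u
                unfolding coords eB[OF that] by (rule image_eqI[of _ _ "ip U u (e 1)"]) (simp_all add: mult.commute)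
              ultimately show ?thesis
                unfolding B 3 by (auto simp: frame_comb_2 e(1) vec2_in_coord_space)
            next
              case 4
              then have full: "sub S i = coord_space 2" using S by (simp add: sysG_sigma_def)
              have "x \<in> sub U i" "y \<in> sub U i" using later[OF i 4] laterB[OF i 4] x(1) yB by auto
              moreover from this have "e 1 \<in> sub U i"
                unfolding e z_def
                by (intro complex_vector.subspace_scale[OF sub(1)[OF i]]
                    complex_vector.subspace_diff[OF sub(1)[OF i]])
              ultimately have "frame_comb 2 e c \<in> sub U i" for c
                unfolding frame_comb_2 e(1)
                by (intro complex_vector.subspace_add[OF sub(1)[OF i]]
                    complex_vector.subspace_scale[OF sub(1)[OF i]])
              then show ?thesis unfolding full by (auto simp: coords vec2_in_coord_space)
            qed
          qed
          have "reducing_frame t U (sysG_sigma k s) 2 e"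
            unfolding reducing_frame_def
          proof (intro conjI)
            show "\<forall>j<2. e j \<in> carr U" using xc e1 e(1) by (auto simp: less_2_cases_iff)
            show "\<forall>i<2. \<forall>j<2. ip U (e i) (e j) = (if i = j then 1 else 0)"
              using x(2) e01 e10 e11 e(1) by (auto simp: less_2_cases_iff)
          qed (use frame in \<open>auto simp: sysG_sigma_def\<close>)
          moreover have "sysG_sigma k s \<in> semichain_summands r t p"
            using s True k(1) by (auto simp: semichain_summands_def)
          ultimately show thesis using frame_thesis[of "sysG_sigma k s" 2 e] by simp
        qed
      qed
    qed
  qed
qed

text \<open>
  Summands are split off one at a time. A basis of the complement together with the first
  frame vector is independent, hence not larger than a finite spanning set of the whole space;
  this makes induction on the size of a spanning set possible.
\<close>

lemma decomposition_exists:
  assumes gaps: "semichain_gaps r t p" and P: "P_system r t p U"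
  shows "\<exists>Ss. set Ss \<subseteq> semichain_summands r t p \<and> isometric t U (orth_sum Ss)"
proof -
  have "unitary_space U" using P by (simp add: P_system_def)
  then obtain B where "finite B" "cspan B = carr U" using unitary_space.finite_dim by blast
  then show ?thesis using P
  proof (induction "card B" arbitrary: B U rule: less_induct)
    case (less B U)
    interpret unitary_space U using less.prems by (simp add: P_system_def)
    have sub: "csubspace (sub U i)" "sub U i \<subseteq> carr U" if "i \<in> {1..t}" for i
      using less.prems(3) that by (auto simp: P_system_def)
    show ?case
    proof (cases "carr U = {0}")
      case True
      have "sub U i = {0}" if "i \<in> {1..t}" for i
        using sub[OF that] True complex_vector.subspace_0 by auto
      then have "isometry_via t U (orth_sum []) (\<lambda>_. 0)"
        unfolding isometry_via_def linear_on_def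
        by (auto simp: True orth_sum_Nil bij_betw_def complex_vector.scale_zero_right ip_zero_left[OF carr_0])
          (simp add: orth_sum_def)
      then show ?thesis by (intro exI[of _ "[]"]) (auto simp: isometric_iff)
    next
      case False
      obtain S n e where S: "S \<in> semichain_summands r t p" and n: "0 < n"
        and F: "reducing_frame t U S n e"
        by (rule exists_reducing_frame[OF less.prems(3) gaps False])
      let ?C = "frame_complement U n e"
      have e: "\<forall>j<n. e j \<in> carr U" and e00: "ip U (e 0) (e 0) = 1"
        using F n by (auto simp: reducing_frame_def)
      have PC: "P_system r t p ?C" by (rule P_system_frame_complement[OF less.prems(3) e])
      have C: "csubspace (carr ?C)" "carr ?C \<subseteq> carr U" "e 0 \<notin> carr ?C"
      proof -
        have "unitary_space ?C" using PC by (simp add: P_system_def)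
        then show "csubspace (carr ?C)" by (rule unitary_space.subspace_carr)
        show "carr ?C \<subseteq> carr U" "e 0 \<notin> carr ?C"
          using n e00 by (auto simp: frame_complement_def)
      qed
      obtain B' where B': "finite B'" "complex_vector.independent B'" "B' \<subseteq> carr ?C" "cspan B' = carr ?C"
        by (rule finite_spanning_set[OF C(1,2)])
      have "complex_vector.independent (insert (e 0) B')"
        using complex_vector.independent_insertI B' C(3) by metis
      moreover have "insert (e 0) B' \<subseteq> cspan B" using B' C less.prems(2) e n by auto
      ultimately have "card (insert (e 0) B') \<le> card B"
        using complex_vector.independent_span_bound[OF less.prems(1)] by blast
      moreover have "e 0 \<notin> B'" using B'(3) C(3) by auto
      ultimately have "card B' < card B" using B'(1) by simp
      then obtain Ss where Ss: "set Ss \<subseteq> semichain_summands r t p" "isometric t ?C (orth_sum Ss)"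
        using less.hyps[OF _ B'(1,4) PC] by blast
      have all: "set (S # Ss) \<subseteq> semichain_summands r t p" using S Ss by simp
      then have conf: "configuration t (orth_sum (S # Ss))"
        using configuration_orth_sum configuration_summand by blast
      have sub': "\<forall>i\<in>{1..t}. sub U i \<subseteq> carr U" using sub by blast
      have "isometric t U (orth_sum2 S ?C)" by (rule isometric_split_off[OF less.prems(3) F])
      then have "isometric t U (orth_sum2 S (orth_sum Ss))"
        using isometric_trans isometric_orth_sum2[OF Ss(2)] sub' by blast
      then have "isometric t U (orth_sum (S # Ss))"
        using isometric_trans isometric_sym[OF orth_sum_Cons conf] sub' by blast
      then show ?thesis using all by blast
    qed
  qed
qed

lemma configuration_P_system:
  assumes "P_system r t p U" shows "configuration t U"
proof -
  interpret unitary_space U using assms by (simp add: P_system_def)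
  show ?thesis using assms subspace_carr ip_zero_right by (auto simp: configuration_def P_system_def)
qed

lemma semichain_decomposition:
  assumes "semichain_gaps r t p" "P_system r t p U"
  shows "\<exists>Ss. set Ss \<subseteq> semichain_summands r t p \<and> isometric t U (orth_sum Ss) \<and>
    (\<forall>Ts. set Ts \<subseteq> semichain_summands r t p \<and> isometric t U (orth_sum Ts) \<longrightarrow> mset Ts = mset Ss)"
proof -
  obtain Ss where "set Ss \<subseteq> semichain_summands r t p" "isometric t U (orth_sum Ss)"
    using decomposition_exists[OF assms] by (elim exE conjE)
  then show ?thesis
    using decomposition_unique[OF configuration_P_system[OF assms(2)]]
    by (intro exI[of _ Ss] conjI allI impI) (auto elim: conjE)
qed

theorem theorem2:
  fixes P :: "'p set" and r :: "'p rel" and t :: nat and p :: "nat \<Rightarrow> 'p"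
  assumes "enumerated_poset P r t p"
  shows
    "(poset_chain r t p \<longrightarrow>
       (\<forall>U :: 'a::complex_vector subspace_system. P_system r t p U \<longrightarrow>
         (\<exists>Ss. set Ss \<subseteq> chain_summands t \<and> isometric t U (orth_sum Ss) \<and>
           (\<forall>Ts. set Ts \<subseteq> chain_summands t \<and> isometric t U (orth_sum Ts)
              \<longrightarrow> mset Ts = mset Ss)))) \<and>
     (poset_semichain P r \<longrightarrow>
       (\<forall>U :: 'a::complex_vector subspace_system. P_system r t p U \<longrightarrow>
         (\<exists>Ss. set Ss \<subseteq> semichain_summands r t p \<and> isometric t U (orth_sum Ss) \<and>
           (\<forall>Ts. set Ts \<subseteq> semichain_summands r t p \<and> isometric t U (orth_sum Ts)
              \<longrightarrow> mset Ts = mset Ss))))"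
proof (intro conjI impI allI)
  fix U :: "'a subspace_system" assume chain: "poset_chain r t p" and U: "P_system r t p U"
  show "\<exists>Ss. set Ss \<subseteq> chain_summands t \<and> isometric t U (orth_sum Ss) \<and>
      (\<forall>Ts. set Ts \<subseteq> chain_summands t \<and> isometric t U (orth_sum Ts) \<longrightarrow> mset Ts = mset Ss)"
    using semichain_decomposition[OF semichain_gaps_poset_chain[OF assms chain] U]
    unfolding semichain_summands_poset_chain[OF chain] .
next
  fix U :: "'a subspace_system" assume semichain: "poset_semichain P r" and U: "P_system r t p U"
  show "\<exists>Ss. set Ss \<subseteq> semichain_summands r t p \<and> isometric t U (orth_sum Ss) \<and>
      (\<forall>Ts. set Ts \<subseteq> semichain_summands r t p \<and> isometric t U (orth_sum Ts)
         \<longrightarrow> mset Ts = mset Ss)"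
    by (rule semichain_decomposition[OF semichain_gaps_poset_semichain[OF assms semichain] U])
qed

end
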